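(* Let $((A,\mu),(A^*,\gamma))$ be a Lie bialgebroid. Let $N:A\to A$ be a vector bundle endomorphism proportional to an almost cps structure on $A$, and assume that $N$ is a Nijenhuis tensor for $(A,\mu)$ and $(A^*,\gamma)$, i.e., $T_\mu N=0$ and $T_\gamma\,{}^tN=0$. Then $\mathcal N=\begin{pmatrix}N&0\\0&-{}^tN\end{pmatrix}$ is a Nijenhuis tensor for the Courant algebroid $(A\oplus A^*,\mu+\gamma)$.
   Context: Let $A$ be a (smooth, real, finite rank) vector bundle over a manifold $M$, and equip $E=A\oplus A^*$ with the canonical symmetric bilinear form $\langle X+\xi,Y+\eta\rangle=\xi(Y)+\eta(X)$. $\mathcal A=\bigoplus_k\mathcal A^k$ is the graded algebra of functions on the graded manifold $T^*[2]A[1]$, with its canonical Poisson bracket $\{\cdot,\cdot\}$ of degree $-2$ (the big bracket). For a local basis $(e_\alpha)$ of $\Gamma A$ with dual basis $(\epsilon^\alpha)$, local coordinates are $(x^i,\tau^\alpha,p_i,\theta_\alpha)$ of degrees $0,1,2,1$, with non-vanishing brackets $\{x^i,p_j\}=\delta^i_j$, $\{\tau^\alpha,\theta_\beta\}=\delta^\alpha_\beta$. $\mathcal A^0=C^\infty(M)$; $\mathcal A^1=\Gamma(A\oplus A^* )$, with $X=X^\alpha e_\alpha$ identified with $X^\alpha\theta_\alpha$ and $\xi=\xi_\alpha\epsilon^\alpha$ with $\xi_\alpha\tau^\alpha$; $\{u,v\}=\langle u,v\rangle$ for sections of $E$. A Lie algebroid structure on $A$ is given by $\mu\in\mathcal A^3$,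 locally a combination with coefficients in $C^\infty(M)$ of terms $\tau^\alpha p_i$ and $\tau^\alpha\tau^\beta\theta_\gamma$, with $\{\mu,\mu\}=0$: anchor $\rho(X)f=\{\{X,\mu\},f\}$, bracket $[X,Y]^\mu=\{\{X,\mu\},Y\}$. A Lie algebroid structure on $A^*$ is given similarly by $\gamma\in\mathcal A^3$ (terms $\theta_\alpha p_i$ and $\theta_\alpha\theta_\beta\tau^\gamma$), $\{\gamma,\gamma\}=0$, $[\xi,\eta]^\gamma=\{\{\xi,\gamma\},\eta\}$. They form a Lie bialgebroid iff moreover $\{\mu,\gamma\}=0$. Then $\mu+\gamma$ makes $A\oplus A^*$ a Courant algebroid (the double), with (Dorfman) bracket $[u,v]=\{\{u,\mu+\gamma\},v\}$ on $\Gamma(A\oplus A^* )$ and anchor $\rho(u)f=\{\{u,\mu+\gamma\},f\}$. The torsion of an endomorphism $P$ for a bracket $[\cdot,\cdot]$ is $(u,v)\mapsto[Pu,Pv]-P([Pu,v]+[u,Pv]-P[u,v])$. $T_\mu N$ and $T_\gamma{}^tN$ are the torsions of $N$ and its transpose ${}^tN:A^*\to A^*$ for $[\cdot,\cdot]^\mu$ and $[\cdot,\cdot]^\gamma$. A Nijenhuis tensor for a Courant algebroid $E$ is an endomorphism $\mathcal N$ which is skew-symmetric ($\langle\mathcal Nu,v\rangle+\langle u,\mathcal Nv\rangle=0$) and has vanishing torsion for the Dorfman bracket. An almost cps structure on $A$ is an endomorphism $N$ with $N^2=\epsilon\,\mathrm{Id}_A$, $\epsilon\in\{-1,1,0\}$;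 "proportional to" means equal to a real constant multiple of. *)

theory Defs
  imports "HOL-Analysis.Analysis" "HOL-Library.Function_Algebras" "HOL-Library.Multiset"
begin

section \<open>Smooth maps\<close>

text \<open>On an open subset of a finite-dimensional space, the following is the class C^k
  (continuity of the derivatives of order less than k follows from their differentiability).\<close>

fun Ck_on :: "nat \<Rightarrow> 'e::real_normed_vector set \<Rightarrow> ('e \<Rightarrow> 'f::real_normed_vector) \<Rightarrow> bool" where
  "Ck_on 0 S f \<longleftrightarrow> continuous_on S f"
| "Ck_on (Suc k) S f \<longleftrightarrow> (\<forall>x\<in>S. f differentiable (at x)) \<and>
     (\<forall>v. Ck_on k S (\<lambda>x. frechet_derivative f (at x) v))"

definition smooth_on :: "'e::real_normed_vector set \<Rightarrow> ('e \<Rightarrow> 'f::real_normed_vector) \<Rightarrow> bool" where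
  "smooth_on S f \<longleftrightarrow> (\<forall>k. Ck_on k S f)"


section \<open>Smooth vector bundles\<close>

text \<open>The base manifold is the whole (Hausdorff, second countable) type \<^typ>\<open>'m\<close>, the total space
  of the bundle is the whole type \<^typ>\<open>'a\<close>. The model space of the base is a real inner product
  space \<^typ>\<open>'e\<close> with a finite orthonormal basis \<open>ebasis 0, ..., ebasis (dimM - 1)\<close>; unlike
  \<open>euclidean_space\<close> this admits dimension 0, so that a Lie bialgebra (base a point) is a case of
  a Lie bialgebroid. A chart of the bundle consists of a coordinate system on an open set of the
  base together with a trivialization over that set; the fibre coordinates of a vector are
  the values at \<open>0, ..., rk - 1\<close> of a function on the natural numbers that vanishes from \<open>rk\<close> on.
  Such charts form a smooth atlas of the base and determine the topology and the smooth structure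
  of the total space.\<close>

record ('m, 'a, 'e) vb_chart =
  cdom :: "'m set"
  coord :: "'m \<Rightarrow> 'e"
  triv :: "'a \<Rightarrow> nat \<Rightarrow> real"

record ('m, 'a, 'e) vbundle =
  dimM :: nat
  rk :: nat
  ebasis :: "nat \<Rightarrow> 'e"
  proj :: "'a \<Rightarrow> 'm"
  fzero :: "'m \<Rightarrow> 'a"
  fadd :: "'a \<Rightarrow> 'a \<Rightarrow> 'a"
  fscale :: "real \<Rightarrow> 'a \<Rightarrow> 'a"
  atlas :: "('m, 'a, 'e) vb_chart set"

definition cimage :: "('m, 'a, 'e) vb_chart \<Rightarrow> 'e set" where
  "cimage c = coord c ` cdom c"

definition cpoint :: "('m, 'a, 'e) vb_chart \<Rightarrow> 'e \<Rightarrow> 'm" where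
  "cpoint c = inv_into (cdom c) (coord c)"

definition fibre :: "('m, 'a, 'e) vbundle \<Rightarrow> 'm \<Rightarrow> 'a set" where
  "fibre A x = {a. proj A a = x}"

text \<open>\<open>frame A c x \<alpha>\<close> is the value at \<open>x\<close> of the element \<open>e\<^sub>\<alpha>\<close> of the local basis of sections
  given by the chart \<open>c\<close>.\<close>

definition frame :: "('m, 'a, 'e) vbundle \<Rightarrow> ('m, 'a, 'e) vb_chart \<Rightarrow> 'm \<Rightarrow> nat \<Rightarrow> 'a" where
  "frame A c x \<alpha> = inv_into (fibre A x) (triv c) (\<lambda>\<beta>. if \<beta> = \<alpha> then 1 else 0)"

text \<open>Matrix of the change of trivialization from \<open>c\<close> to \<open>d\<close>: a vector with components \<open>v\<^sup>\<beta>\<close> in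
  \<open>c\<close> has components \<open>\<Sum>\<^sub>\<beta> tmat A c d x \<alpha> \<beta> v\<^sup>\<beta>\<close> in \<open>d\<close>.\<close>

definition tmat :: "('m, 'a, 'e) vbundle \<Rightarrow> ('m, 'a, 'e) vb_chart \<Rightarrow> ('m, 'a, 'e) vb_chart \<Rightarrow>
    'm \<Rightarrow> nat \<Rightarrow> nat \<Rightarrow> real" where
  "tmat A c d x \<alpha> \<beta> = triv d (frame A c x \<beta>) \<alpha>"

definition vector_bundle ::
    "('m::{t2_space,second_countable_topology}, 'a, 'e::real_inner) vbundle \<Rightarrow> bool" where
  "vector_bundle A \<longleftrightarrow>
     (\<forall>i<dimM A. \<forall>j<dimM A. ebasis A i \<bullet> ebasis A j = (if i = j then 1 else 0)) \<and>
     span (ebasis A ` {..<dimM A}) = UNIV \<and>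
     (\<Union>c\<in>atlas A. cdom c) = UNIV \<and>
     (\<forall>x. fzero A x \<in> fibre A x) \<and>
     (\<forall>x. \<forall>a\<in>fibre A x. \<forall>b\<in>fibre A x. fadd A a b \<in> fibre A x) \<and>
     (\<forall>x. \<forall>a\<in>fibre A x. \<forall>t. fscale A t a \<in> fibre A x) \<and>
     (\<forall>c\<in>atlas A. open (cdom c) \<and> open (cimage c) \<and>
        homeomorphism (cdom c) (cimage c) (coord c) (cpoint c)) \<and>
     (\<forall>c\<in>atlas A. \<forall>x\<in>cdom c.
        bij_betw (triv c) (fibre A x) {v. \<forall>\<alpha>\<ge>rk A. v \<alpha> = 0} \<and>
        triv c (fzero A x) = (\<lambda>\<alpha>. 0) \<and>
        (\<forall>a\<in>fibre A x. \<forall>b\<in>fibre A x. triv c (fadd A a b) = (\<lambda>\<alpha>. triv c a \<alpha> + triv c b \<alpha>)) \<and>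
        (\<forall>a\<in>fibre A x. \<forall>t. triv c (fscale A t a) = (\<lambda>\<alpha>. t * triv c a \<alpha>))) \<and>
     (\<forall>c\<in>atlas A. \<forall>d\<in>atlas A.
        smooth_on (coord c ` (cdom c \<inter> cdom d)) (coord d \<circ> cpoint c) \<and>
        (\<forall>\<alpha><rk A. \<forall>\<beta><rk A.
           smooth_on (coord c ` (cdom c \<inter> cdom d)) (\<lambda>y. tmat A c d (cpoint c y) \<alpha> \<beta>)))"


subsection \<open>Functions, sections of A, of its dual, and of their direct sum E\<close>

definition smooth_funs :: "('m, 'a, 'e::real_inner) vbundle \<Rightarrow> ('m \<Rightarrow> real) set" where
  "smooth_funs A = {f. \<forall>c\<in>atlas A. smooth_on (cimage c) (f \<circ> cpoint c)}"

definition sec :: "('m, 'a, 'e::real_inner) vbundle \<Rightarrow> ('m \<Rightarrow> 'a) set" where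
  "sec A = {X. (\<forall>x. X x \<in> fibre A x) \<and>
     (\<forall>c\<in>atlas A. \<forall>\<alpha><rk A. smooth_on (cimage c) (\<lambda>y. triv c (X (cpoint c y)) \<alpha>))}"

text \<open>A section of the dual bundle is a function on the total space that is linear on each
  fibre; its components are its values on the frame.\<close>

definition dsec :: "('m, 'a, 'e::real_inner) vbundle \<Rightarrow> ('a \<Rightarrow> real) set" where
  "dsec A = {\<xi>. (\<forall>x. \<forall>a\<in>fibre A x. \<forall>b\<in>fibre A x. \<xi> (fadd A a b) = \<xi> a + \<xi> b) \<and>
     (\<forall>a t. \<xi> (fscale A t a) = t * \<xi> a) \<and>
     (\<forall>c\<in>atlas A. \<forall>\<alpha><rk A. smooth_on (cimage c) (\<lambda>y. \<xi> (frame A c (cpoint c y) \<alpha>)))}"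

type_synonym ('m, 'a) esection = "('m \<Rightarrow> 'a) \<times> ('a \<Rightarrow> real)"

definition esec :: "('m, 'a, 'e::real_inner) vbundle \<Rightarrow> ('m, 'a) esection set" where
  "esec A = sec A \<times> dsec A"

definition sadd :: "('m, 'a, 'e) vbundle \<Rightarrow> ('m \<Rightarrow> 'a) \<Rightarrow> ('m \<Rightarrow> 'a) \<Rightarrow> ('m \<Rightarrow> 'a)" where
  "sadd A X Y = (\<lambda>x. fadd A (X x) (Y x))"

definition smul :: "('m, 'a, 'e) vbundle \<Rightarrow> ('m \<Rightarrow> real) \<Rightarrow> ('m \<Rightarrow> 'a) \<Rightarrow> ('m \<Rightarrow> 'a)" where
  "smul A f X = (\<lambda>x. fscale A (f x) (X x))"

definition ssub :: "('m, 'a, 'e) vbundle \<Rightarrow> ('m \<Rightarrow> 'a) \<Rightarrow> ('m \<Rightarrow> 'a) \<Rightarrow> ('m \<Rightarrow> 'a)" where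
  "ssub A X Y = sadd A X (smul A (\<lambda>_. -1) Y)"

definition ezero :: "('m, 'a, 'e) vbundle \<Rightarrow> ('m, 'a) esection" where
  "ezero A = (fzero A, 0)"

definition eadd :: "('m, 'a, 'e) vbundle \<Rightarrow> ('m, 'a) esection \<Rightarrow> ('m, 'a) esection \<Rightarrow>
    ('m, 'a) esection" where
  "eadd A u v = (sadd A (fst u) (fst v), snd u + snd v)"

definition esub :: "('m, 'a, 'e) vbundle \<Rightarrow> ('m, 'a) esection \<Rightarrow> ('m, 'a) esection \<Rightarrow>
    ('m, 'a) esection" where
  "esub A u v = (ssub A (fst u) (fst v), snd u - snd v)"

definition emul :: "('m, 'a, 'e) vbundle \<Rightarrow> ('m \<Rightarrow> real) \<Rightarrow> ('m, 'a) esection \<Rightarrow>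
    ('m, 'a) esection" where
  "emul A f u = (smul A f (fst u), \<lambda>a. f (proj A a) * snd u a)"

definition pairing :: "('m, 'a) esection \<Rightarrow> ('m, 'a) esection \<Rightarrow> 'm \<Rightarrow> real" where
  "pairing u v = (\<lambda>x. snd u (fst v x) + snd v (fst u x))"


subsection \<open>Endomorphisms\<close>

definition bundle_endo :: "('m, 'a, 'e::real_inner) vbundle \<Rightarrow> ('a \<Rightarrow> 'a) \<Rightarrow> bool" where
  "bundle_endo A N \<longleftrightarrow>
     (\<forall>x. \<forall>a\<in>fibre A x. N a \<in> fibre A x) \<and>
     (\<forall>x. \<forall>a\<in>fibre A x. \<forall>b\<in>fibre A x. N (fadd A a b) = fadd A (N a) (N b)) \<and>
     (\<forall>a t. N (fscale A t a) = fscale A t (N a)) \<and>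
     (\<forall>c\<in>atlas A. \<forall>\<alpha><rk A. \<forall>\<beta><rk A.
        smooth_on (cimage c) (\<lambda>y. triv c (N (frame A c (cpoint c y) \<beta>)) \<alpha>))"

text \<open>Endomorphisms of E as endomorphisms of the module of its sections over the smooth
  functions.\<close>

definition e_endo :: "('m, 'a, 'e::real_inner) vbundle \<Rightarrow>
    (('m, 'a) esection \<Rightarrow> ('m, 'a) esection) \<Rightarrow> bool" where
  "e_endo A P \<longleftrightarrow>
     (\<forall>u\<in>esec A. P u \<in> esec A) \<and>
     (\<forall>u\<in>esec A. \<forall>v\<in>esec A. P (eadd A u v) = eadd A (P u) (P v)) \<and>
     (\<forall>f\<in>smooth_funs A. \<forall>u\<in>esec A. P (emul A f u) = emul A f (P u))"

definition sec_endo :: "('a \<Rightarrow> 'a) \<Rightarrow> ('m \<Rightarrow> 'a) \<Rightarrow> ('m \<Rightarrow> 'a)" where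
  "sec_endo N X = N \<circ> X"

definition transpose_endo :: "('a \<Rightarrow> 'a) \<Rightarrow> ('a \<Rightarrow> real) \<Rightarrow> ('a \<Rightarrow> real)" where
  "transpose_endo N \<xi> = \<xi> \<circ> N"

definition block_endo :: "('a \<Rightarrow> 'a) \<Rightarrow> ('m, 'a) esection \<Rightarrow> ('m, 'a) esection" where
  "block_endo N u = (sec_endo N (fst u), - transpose_endo N (snd u))"

definition almost_cps :: "('m, 'a, 'e::real_inner) vbundle \<Rightarrow> ('a \<Rightarrow> 'a) \<Rightarrow> bool" where
  "almost_cps A N \<longleftrightarrow> bundle_endo A N \<and> (\<exists>\<epsilon>\<in>{-1, 1, 0}. \<forall>a. N (N a) = fscale A \<epsilon> a)"

definition proportional :: "('m, 'a, 'e) vbundle \<Rightarrow> ('a \<Rightarrow> 'a) \<Rightarrow> ('a \<Rightarrow> 'a) \<Rightarrow> bool" where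
  "proportional A N P \<longleftrightarrow> (\<exists>t. \<forall>a. N a = fscale A t (P a))"


section \<open>The graded Poisson algebra in local coordinates\<close>

text \<open>An element of \<open>galg\<close> is the family of coefficients of a polynomial in the even variables
  \<open>p\<^sub>i\<close> and the odd variables \<open>\<tau>\<^sup>\<alpha>\<close>, \<open>\<theta>\<^sub>\<alpha>\<close>. The odd variable with number \<open>\<alpha>\<close> is \<open>\<tau>\<^sup>\<alpha>\<close>, the one
  with number \<open>r + \<alpha>\<close> is \<open>\<theta>\<^sub>\<alpha>\<close>, for \<open>\<alpha> < r\<close>. A monomial is given by the multiset of the numbers
  of its even factors and the set of the numbers of its odd factors, multiplied in increasing
  order. Addition in \<open>galg\<close> is the pointwise one; multiplication is \<open>gmult\<close>.\<close>

type_synonym galg = "nat multiset \<Rightarrow> nat set \<Rightarrow> real"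

definition gsign :: "nat set \<Rightarrow> nat set \<Rightarrow> real" where
  "gsign S T = (-1) ^ card {(s, t). s \<in> S \<and> t \<in> T \<and> t < s}"

definition gmult :: "galg \<Rightarrow> galg \<Rightarrow> galg" where
  "gmult f g = (\<lambda>I S. \<Sum>J\<in>{J. J \<subseteq># I}. \<Sum>T\<in>Pow S.
     gsign T (S - T) * f J T * g (I - J) (S - T))"

definition gone :: galg where
  "gone = (\<lambda>I S. if I = {#} \<and> S = {} then 1 else 0)"

definition gscale :: "real \<Rightarrow> galg \<Rightarrow> galg" where
  "gscale t f = (\<lambda>I S. t * f I S)"

definition gprod :: "galg list \<Rightarrow> galg" where
  "gprod fs = foldr gmult fs gone"

definition pvar :: "nat \<Rightarrow> galg" where
  "pvar i = (\<lambda>I S. if I = {#i#} \<and> S = {} then 1 else 0)"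

definition ovar :: "nat \<Rightarrow> galg" where
  "ovar k = (\<lambda>I S. if I = {#} \<and> S = {k} then 1 else 0)"

definition pderiv_p :: "nat \<Rightarrow> galg \<Rightarrow> galg" where
  "pderiv_p i f = (\<lambda>I S. real (count I i + 1) * f (add_mset i I) S)"

definition left_deriv :: "nat \<Rightarrow> galg \<Rightarrow> galg" where
  "left_deriv k f = (\<lambda>I S. if k \<in> S then 0 else (-1) ^ card {s\<in>S. s < k} * f I (insert k S))"

definition right_deriv :: "nat \<Rightarrow> galg \<Rightarrow> galg" where
  "right_deriv k f = (\<lambda>I S. if k \<in> S then 0 else (-1) ^ card {s\<in>S. k < s} * f I (insert k S))"

definition pderiv_x :: "'e::real_inner \<Rightarrow> ('e \<Rightarrow> galg) \<Rightarrow> ('e \<Rightarrow> galg)" where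
  "pderiv_x b F = (\<lambda>y I S. frechet_derivative (\<lambda>z. F z I S) (at y) b)"

text \<open>The bracket of degree -2 that is a graded biderivation and whose only non-vanishing
  values on coordinates are \<open>{x\<^sup>i, p\<^sub>i} = 1 = - {p\<^sub>i, x\<^sup>i}\<close> and
  \<open>{\<tau>\<^sup>\<alpha>, \<theta>\<^sub>\<alpha>} = 1 = {\<theta>\<^sub>\<alpha>, \<tau>\<^sup>\<alpha>}\<close>.\<close>

definition lpoisson :: "('m, 'a, 'e::real_inner) vbundle \<Rightarrow> ('e \<Rightarrow> galg) \<Rightarrow> ('e \<Rightarrow> galg) \<Rightarrow>
    ('e \<Rightarrow> galg)" where
  "lpoisson A F G = (\<lambda>y.
     (\<Sum>i<dimM A. gmult (pderiv_x (ebasis A i) F y) (pderiv_p i (G y))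
                - gmult (pderiv_p i (F y)) (pderiv_x (ebasis A i) G y)) +
     (\<Sum>\<alpha><rk A. gmult (right_deriv \<alpha> (F y)) (left_deriv (rk A + \<alpha>) (G y))
               + gmult (right_deriv (rk A + \<alpha>) (F y)) (left_deriv \<alpha> (G y))))"


section \<open>Functions on the graded manifold\<close>

text \<open>A function on the graded manifold is a family of local expressions, one for each chart
  \<open>c\<close> and meaningful on \<open>cimage c\<close>, that are related by the changes of coordinates. For charts
  \<open>c\<close> (coordinates \<open>x, \<tau>, p, \<theta>\<close>) and \<open>d\<close> (coordinates \<open>x', \<tau>', p', \<theta>'\<close>), with \<open>g\<close> the change
  of trivialization from \<open>c\<close> to \<open>d\<close> and \<open>h\<close> its inverse, the latter are the cotangent lifts of
  \<open>x' = x'(x)\<close>, \<open>\<tau>'\<^sup>\<alpha> = g\<^sup>\<alpha>\<^sub>\<beta> \<tau>\<^sup>\<beta>\<close>: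

  \<open>\<theta>'\<^sub>\<alpha> = h\<^sup>\<beta>\<^sub>\<alpha> \<theta>\<^sub>\<beta>\<close>, and
  \<open>p'\<^sub>j = (\<partial>x\<^sup>i/\<partial>x'\<^sup>j) p\<^sub>i - (\<partial>h\<^sup>\<alpha>\<^sub>\<beta>/\<partial>x'\<^sup>j) g\<^sup>\<beta>\<^sub>\<gamma> \<tau>\<^sup>\<gamma> \<theta>\<^sub>\<alpha>\<close>.

  The sign of the last term is the one for which the change of coordinates preserves the
  brackets of the coordinates.\<close>

type_synonym ('m, 'a, 'e) gfun = "('m, 'a, 'e) vb_chart \<Rightarrow> 'e \<Rightarrow> galg"

definition trans_tau :: "('m, 'a, 'e) vbundle \<Rightarrow> ('m, 'a, 'e) vb_chart \<Rightarrow>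
    ('m, 'a, 'e) vb_chart \<Rightarrow> 'm \<Rightarrow> nat \<Rightarrow> galg" where
  "trans_tau A c d x \<alpha> = (\<Sum>\<beta><rk A. gscale (tmat A c d x \<alpha> \<beta>) (ovar \<beta>))"

definition trans_theta :: "('m, 'a, 'e) vbundle \<Rightarrow> ('m, 'a, 'e) vb_chart \<Rightarrow>
    ('m, 'a, 'e) vb_chart \<Rightarrow> 'm \<Rightarrow> nat \<Rightarrow> galg" where
  "trans_theta A c d x \<alpha> = (\<Sum>\<beta><rk A. gscale (tmat A d c x \<beta> \<alpha>) (ovar (rk A + \<beta>)))"

definition trans_odd :: "('m, 'a, 'e) vbundle \<Rightarrow> ('m, 'a, 'e) vb_chart \<Rightarrow>
    ('m, 'a, 'e) vb_chart \<Rightarrow> 'm \<Rightarrow> nat \<Rightarrow> galg" where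
  "trans_odd A c d x k =
     (if k < rk A then trans_tau A c d x k else trans_theta A c d x (k - rk A))"

definition trans_p :: "('m, 'a, 'e::real_inner) vbundle \<Rightarrow> ('m, 'a, 'e) vb_chart \<Rightarrow>
    ('m, 'a, 'e) vb_chart \<Rightarrow> 'm \<Rightarrow> nat \<Rightarrow> galg" where
  "trans_p A c d x j =
     (\<Sum>i<dimM A. gscale (frechet_derivative (coord c \<circ> cpoint d) (at (coord d x)) (ebasis A j)
                          \<bullet> ebasis A i) (pvar i)) -
     (\<Sum>\<alpha><rk A. \<Sum>\<beta><rk A.
        gscale (frechet_derivative (\<lambda>z. tmat A d c (cpoint d z) \<alpha> \<beta>) (at (coord d x)) (ebasis A j))
          (gmult (trans_tau A c d x \<beta>) (ovar (rk A + \<alpha>))))"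

definition monomials :: "('m, 'a, 'e) vbundle \<Rightarrow> nat \<Rightarrow> (nat multiset \<times> nat set) set" where
  "monomials A k = {(I, S). set_mset I \<subseteq> {..<dimM A} \<and> S \<subseteq> {..<2 * rk A} \<and> 2 * size I + card S = k}"

text \<open>The homogeneous component of degree \<open>k\<close> of the algebra of functions.\<close>

definition gfuns :: "('m, 'a, 'e::real_inner) vbundle \<Rightarrow> nat \<Rightarrow> ('m, 'a, 'e) gfun set" where
  "gfuns A k = {F.
     (\<forall>c\<in>atlas A. \<forall>y\<in>cimage c. \<forall>I S. F c y I S \<noteq> 0 \<longrightarrow> (I, S) \<in> monomials A k) \<and>
     (\<forall>c\<in>atlas A. \<forall>I S. smooth_on (cimage c) (\<lambda>y. F c y I S)) \<and>
     (\<forall>c\<in>atlas A. \<forall>d\<in>atlas A. \<forall>x\<in>cdom c \<inter> cdom d.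
        F c (coord c x) = (\<Sum>(I, S)\<in>monomials A k. gscale (F d (coord d x) I S)
          (gmult (gprod (map (trans_p A c d x) (sorted_list_of_multiset I)))
                 (gprod (map (trans_odd A c d x) (sorted_list_of_set S))))))}"

definition big_bracket :: "('m, 'a, 'e::real_inner) vbundle \<Rightarrow> ('m, 'a, 'e) gfun \<Rightarrow>
    ('m, 'a, 'e) gfun \<Rightarrow> ('m, 'a, 'e) gfun" where
  "big_bracket A F G = (\<lambda>c. lpoisson A (F c) (G c))"

definition gfun_vanishes :: "('m, 'a, 'e) vbundle \<Rightarrow> ('m, 'a, 'e) gfun \<Rightarrow> bool" where
  "gfun_vanishes A F \<longleftrightarrow> (\<forall>c\<in>atlas A. \<forall>y\<in>cimage c. F c y = 0)"


subsection \<open>Identification of sections with functions of degree 1\<close>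

definition of_esec :: "('m, 'a, 'e) vbundle \<Rightarrow> ('m, 'a) esection \<Rightarrow> ('m, 'a, 'e) gfun" where
  "of_esec A u = (\<lambda>c y. \<Sum>\<alpha><rk A.
     gscale (triv c (fst u (cpoint c y)) \<alpha>) (ovar (rk A + \<alpha>)) +
     gscale (snd u (frame A c (cpoint c y) \<alpha>)) (ovar \<alpha>))"

text \<open>The inverse identification: the value at a point is read off in any chart around it,
  the choice being irrelevant for functions of degree 1.\<close>

definition chart_at :: "('m, 'a, 'e) vbundle \<Rightarrow> 'm \<Rightarrow> ('m, 'a, 'e) vb_chart" where
  "chart_at A x = (SOME c. c \<in> atlas A \<and> x \<in> cdom c)"

definition sec_part :: "('m, 'a, 'e) vbundle \<Rightarrow> ('m, 'a, 'e) gfun \<Rightarrow> ('m \<Rightarrow> 'a)" where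
  "sec_part A F = (\<lambda>x. let c = chart_at A x in inv_into (fibre A x) (triv c)
     (\<lambda>\<alpha>. if \<alpha> < rk A then F c (coord c x) {#} {rk A + \<alpha>} else 0))"

definition dsec_part :: "('m, 'a, 'e) vbundle \<Rightarrow> ('m, 'a, 'e) gfun \<Rightarrow> ('a \<Rightarrow> real)" where
  "dsec_part A F = (\<lambda>a. let x = proj A a; c = chart_at A x in
     \<Sum>\<alpha><rk A. F c (coord c x) {#} {\<alpha>} * triv c a \<alpha>)"

definition to_esec :: "('m, 'a, 'e) vbundle \<Rightarrow> ('m, 'a, 'e) gfun \<Rightarrow> ('m, 'a) esection" where
  "to_esec A F = (sec_part A F, dsec_part A F)"


section \<open>Lie bialgebroids and their doubles\<close>

definition lie_algebroid :: "('m, 'a, 'e::real_inner) vbundle \<Rightarrow> ('m, 'a, 'e) gfun \<Rightarrow> bool" where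
  "lie_algebroid A \<mu> \<longleftrightarrow> \<mu> \<in> gfuns A 3 \<and>
     (\<forall>c\<in>atlas A. \<forall>y\<in>cimage c. \<forall>I S. \<mu> c y I S \<noteq> 0 \<longrightarrow>
        (\<exists>i<dimM A. \<exists>\<alpha><rk A. I = {#i#} \<and> S = {\<alpha>}) \<or>
        (\<exists>\<alpha><rk A. \<exists>\<beta><rk A. \<exists>\<gamma><rk A. \<alpha> \<noteq> \<beta> \<and> I = {#} \<and> S = {\<alpha>, \<beta>, rk A + \<gamma>})) \<and>
     gfun_vanishes A (big_bracket A \<mu> \<mu>)"

definition dual_lie_algebroid :: "('m, 'a, 'e::real_inner) vbundle \<Rightarrow> ('m, 'a, 'e) gfun \<Rightarrow> bool" where
  "dual_lie_algebroid A \<gamma> \<longleftrightarrow> \<gamma> \<in> gfuns A 3 \<and>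
     (\<forall>c\<in>atlas A. \<forall>y\<in>cimage c. \<forall>I S. \<gamma> c y I S \<noteq> 0 \<longrightarrow>
        (\<exists>i<dimM A. \<exists>\<alpha><rk A. I = {#i#} \<and> S = {rk A + \<alpha>}) \<or>
        (\<exists>\<alpha><rk A. \<exists>\<beta><rk A. \<exists>\<kappa><rk A. \<alpha> \<noteq> \<beta> \<and> I = {#} \<and> S = {rk A + \<alpha>, rk A + \<beta>, \<kappa>})) \<and>
     gfun_vanishes A (big_bracket A \<gamma> \<gamma>)"

definition lie_bialgebroid :: "('m, 'a, 'e::real_inner) vbundle \<Rightarrow> ('m, 'a, 'e) gfun \<Rightarrow>
    ('m, 'a, 'e) gfun \<Rightarrow> bool" where
  "lie_bialgebroid A \<mu> \<gamma> \<longleftrightarrow> lie_algebroid A \<mu> \<and> dual_lie_algebroid A \<gamma> \<and>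
     gfun_vanishes A (big_bracket A \<mu> \<gamma>)"

definition derived_bracket :: "('m, 'a, 'e::real_inner) vbundle \<Rightarrow> ('m, 'a, 'e) gfun \<Rightarrow>
    ('m, 'a) esection \<Rightarrow> ('m, 'a) esection \<Rightarrow> ('m, 'a, 'e) gfun" where
  "derived_bracket A \<Theta> u v = big_bracket A (big_bracket A (of_esec A u) \<Theta>) (of_esec A v)"

definition dorfman :: "('m, 'a, 'e::real_inner) vbundle \<Rightarrow> ('m, 'a, 'e) gfun \<Rightarrow>
    ('m, 'a) esection \<Rightarrow> ('m, 'a) esection \<Rightarrow> ('m, 'a) esection" where
  "dorfman A \<Theta> u v = to_esec A (derived_bracket A \<Theta> u v)"

definition lie_bracket :: "('m, 'a, 'e::real_inner) vbundle \<Rightarrow> ('m, 'a, 'e) gfun \<Rightarrow>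
    ('m \<Rightarrow> 'a) \<Rightarrow> ('m \<Rightarrow> 'a) \<Rightarrow> ('m \<Rightarrow> 'a)" where
  "lie_bracket A \<mu> X Y = sec_part A (derived_bracket A \<mu> (X, 0) (Y, 0))"

definition dual_lie_bracket :: "('m, 'a, 'e::real_inner) vbundle \<Rightarrow> ('m, 'a, 'e) gfun \<Rightarrow>
    ('a \<Rightarrow> real) \<Rightarrow> ('a \<Rightarrow> real) \<Rightarrow> ('a \<Rightarrow> real)" where
  "dual_lie_bracket A \<gamma> \<xi> \<eta> =
     dsec_part A (derived_bracket A \<gamma> (fzero A, \<xi>) (fzero A, \<eta>))"


section \<open>Torsion and Nijenhuis tensors\<close>

definition torsion :: "('s \<Rightarrow> 's \<Rightarrow> 's) \<Rightarrow> ('s \<Rightarrow> 's \<Rightarrow> 's) \<Rightarrow> ('s \<Rightarrow> 's \<Rightarrow> 's) \<Rightarrow>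
    ('s \<Rightarrow> 's) \<Rightarrow> 's \<Rightarrow> 's \<Rightarrow> 's" where
  "torsion add sub br P u v =
     sub (br (P u) (P v)) (P (sub (add (br (P u) v) (br u (P v))) (P (br u v))))"

definition nijenhuis :: "('m, 'a, 'e::real_inner) vbundle \<Rightarrow> ('m, 'a, 'e) gfun \<Rightarrow>
    ('a \<Rightarrow> 'a) \<Rightarrow> bool" where
  "nijenhuis A \<mu> N \<longleftrightarrow> (\<forall>X\<in>sec A. \<forall>Y\<in>sec A.
     torsion (sadd A) (ssub A) (lie_bracket A \<mu>) (sec_endo N) X Y = fzero A)"

text \<open>The transpose of \<open>N\<close> is a Nijenhuis tensor for the dual.\<close>

definition dual_nijenhuis :: "('m, 'a, 'e::real_inner) vbundle \<Rightarrow> ('m, 'a, 'e) gfun \<Rightarrow>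
    ('a \<Rightarrow> 'a) \<Rightarrow> bool" where
  "dual_nijenhuis A \<gamma> N \<longleftrightarrow> (\<forall>\<xi>\<in>dsec A. \<forall>\<eta>\<in>dsec A.
     torsion (+) (-) (dual_lie_bracket A \<gamma>) (transpose_endo N) \<xi> \<eta> = 0)"

definition courant_nijenhuis :: "('m, 'a, 'e::real_inner) vbundle \<Rightarrow> ('m, 'a, 'e) gfun \<Rightarrow>
    (('m, 'a) esection \<Rightarrow> ('m, 'a) esection) \<Rightarrow> bool" where
  "courant_nijenhuis A \<Theta> P \<longleftrightarrow> e_endo A P \<and>
     (\<forall>u\<in>esec A. \<forall>v\<in>esec A. pairing (P u) v + pairing u (P v) = 0) \<and>
     (\<forall>u\<in>esec A. \<forall>v\<in>esec A.
        torsion (eadd A) (esub A) (dorfman A \<Theta>) P u v = ezero A)"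

end

theory Submission
  imports Defs
begin

text \<open>Write \<open>\<N>\<close> for the block endomorphism of \<open>E = A \<oplus> A\<^sup>*\<close>. It is skew-symmetric, and
  \<open>N\<^sup>2 = t Id\<close> for a real constant \<open>t\<close>, hence \<open>\<N>\<^sup>2 = t Id\<close>.

  In a chart, the derived bracket of two sections for a cubic function \<open>\<Theta>\<close> is an explicit
  expression in the 1-jets of their coefficients (\<open>derived_bracket_coef\<close>). Insert it in the
  torsion of \<open>\<N>\<close> at \<open>u, v\<close> and pair with \<open>w\<close>: because \<open>\<N>\<close> is skew-symmetric with square \<open>t Id\<close>,
  the derivatives of \<open>u\<close> and \<open>v\<close> cancel (\<open>jet_torsion_eq_torsion_form\<close>), and what is left is a
  trilinear form \<open>T\<^sub>\<Theta>(u, v, w)\<close> in the values at the point. Differentiating \<open>\<N>\<^sup>2 = t Id\<close> shows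
  that \<open>\<N>\<close> anticommutes with its derivatives, which makes this form totally antisymmetric
  (\<open>torsion_form_swap12\<close>, \<open>torsion_form_swap23\<close>). It is also additive in \<open>\<Theta>\<close>, so it suffices to
  show that \<open>T\<^sub>\<mu> = 0\<close> and \<open>T\<^sub>\<gamma> = 0\<close>.

  Counting the variables \<open>\<tau>\<close> and \<open>\<theta>\<close> in \<open>\<mu>\<close>, the form \<open>T\<^sub>\<mu>\<close> can be nonzero only if exactly two of
  its arguments lie in \<open>A\<close> and one in \<open>A\<^sup>*\<close>. By antisymmetry, the only case is
  \<open>T\<^sub>\<mu>(X, Y, \<zeta>)\<close> (\<open>torsion_form_eq_0\<close>), and this is the value of \<open>\<zeta>\<close> on the torsion of \<open>N\<close> for
  the bracket of \<open>A\<close> at \<open>X, Y\<close>. The latter is known to vanish for global sections only, but every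
  vector at a point is the value of a global section, by means of bump functions
  (\<open>extend_vector\<close>). In the same way \<open>T\<^sub>\<gamma>\<close> reduces to the torsion of the transpose of \<open>N\<close>, with
  \<open>extend_covector\<close>.\<close>

section \<open>Calculus of C^k maps\<close>

lemma Ck_on_cong:
  assumes "open S" "\<And>x. x \<in> S \<Longrightarrow> f x = g x" "Ck_on k S f"
  shows "Ck_on k S g"
  using assms(2,3)
proof (induction k arbitrary: f g)
  case 0
  then show ?case using continuous_on_cong by force
next
  case (Suc k)
  have der: "(g has_derivative frechet_derivative f (at x)) (at x)" if "x \<in> S" for x
  proof -
    have "(f has_derivative frechet_derivative f (at x)) (at x)"
      using Suc.prems that frechet_derivative_works by auto
    then show ?thesis
      using has_derivative_transform_within_open[OF _ assms(1) that] Suc.prems(1) by blast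
  qed
  then have eq: "frechet_derivative g (at x) = frechet_derivative f (at x)" if "x \<in> S" for x
    using frechet_derivative_at that by metis
  show ?case
    using Suc.IH[of "\<lambda>x. frechet_derivative f (at x) v" "\<lambda>x. frechet_derivative g (at x) v" for v]
      Suc.prems der eq by (auto simp: differentiable_def)
qed

lemma Ck_on_SucI:
  assumes "open S" "\<And>x. x \<in> S \<Longrightarrow> (f has_derivative f' x) (at x)"
    and "\<And>v. Ck_on k S (\<lambda>x. f' x v)"
  shows "Ck_on (Suc k) S f"
proof -
  have "frechet_derivative f (at x) = f' x" if "x \<in> S" for x
    using assms(2)[OF that] frechet_derivative_at by metis
  then have "Ck_on k S (\<lambda>x. frechet_derivative f (at x) v)" for v
    by (intro Ck_on_cong[OF assms(1) _ assms(3)]) simp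
  then show ?thesis using assms(2) by (auto simp: differentiable_def)
qed

lemma Ck_on_SucD:
  assumes "Ck_on (Suc k) S f"
  shows "x \<in> S \<Longrightarrow> (f has_derivative frechet_derivative f (at x)) (at x)"
    and "Ck_on k S (\<lambda>x. frechet_derivative f (at x) v)"
  using assms frechet_derivative_works by auto

lemma Ck_on_Suc_imp: "Ck_on (Suc k) S f \<Longrightarrow> Ck_on k S f"
proof (induction k arbitrary: f)
  case 0
  then have "f differentiable_on S"
    by (simp add: differentiable_on_def differentiable_at_withinI)
  then show ?case using differentiable_imp_continuous_on by simp
next
  case (Suc k)
  then show ?case by auto
qed

lemma Ck_on_Un: "open S \<Longrightarrow> open T \<Longrightarrow> Ck_on k S f \<Longrightarrow> Ck_on k T f \<Longrightarrow> Ck_on k (S \<union> T) f"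
  by (induction k arbitrary: f) (auto intro: continuous_on_open_Un)

lemma Ck_on_const: "open S \<Longrightarrow> Ck_on k S (\<lambda>x. c)"
proof (induction k arbitrary: c)
  case (Suc k)
  show ?case
    by (rule Ck_on_SucI[where f' = "\<lambda>_ _. 0"]) (use Suc in auto)
qed simp

lemma Ck_on_bounded_linear:
  assumes "open S" "bounded_linear L" "Ck_on k S f"
  shows "Ck_on k S (\<lambda>x. L (f x))"
  using assms(3)
proof (induction k arbitrary: f)
  case 0
  then show ?case using bounded_linear.continuous_on[OF assms(2)] by simp
next
  case (Suc k)
  show ?case
    by (rule Ck_on_SucI[OF assms(1), where f' = "\<lambda>x v. L (frechet_derivative f (at x) v)"])
      (use Suc Ck_on_SucD[OF Suc.prems] in
        \<open>auto intro!: bounded_linear.has_derivative[OF assms(2)] Suc.IH\<close>)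
qed

lemma Ck_on_add:
  assumes "open S" "Ck_on k S f" "Ck_on k S g"
  shows "Ck_on k S (\<lambda>x. f x + g x)"
  using assms(2,3)
proof (induction k arbitrary: f g)
  case 0
  then show ?case by (simp add: continuous_on_add)
next
  case (Suc k)
  show ?case
    by (rule Ck_on_SucI[OF assms(1), where
          f' = "\<lambda>x v. frechet_derivative f (at x) v + frechet_derivative g (at x) v"])
      (use Suc.IH Ck_on_SucD[OF Suc.prems(1)] Ck_on_SucD[OF Suc.prems(2)] in
        \<open>auto intro!: has_derivative_add\<close>)
qed

lemma Ck_on_sum:
  assumes "open S" "\<And>i. i \<in> I \<Longrightarrow> Ck_on k S (f i)"
  shows "Ck_on k S (\<lambda>x. \<Sum>i\<in>I. f i x)"
  using assms(2)
proof (induction I rule: infinite_finite_induct)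
  case (insert i I)
  then have "Ck_on k S (\<lambda>x. f i x + (\<Sum>i\<in>I. f i x))"
    by (intro Ck_on_add[OF assms(1)]) auto
  then show ?case using insert.hyps by simp
qed (auto intro: Ck_on_const[OF assms(1)])

lemma Ck_on_bilinear:
  assumes "open S" "bounded_bilinear b" "Ck_on k S f" "Ck_on k S g"
  shows "Ck_on k S (\<lambda>x. b (f x) (g x))"
  using assms(3,4)
proof (induction k arbitrary: f g)
  case 0
  then show ?case using bounded_bilinear.continuous_on[OF assms(2)] by simp
next
  case (Suc k)
  note fg = Ck_on_Suc_imp[OF Suc.prems(1)] Ck_on_Suc_imp[OF Suc.prems(2)]
  show ?case
    by (rule Ck_on_SucI[OF assms(1), where f' = "\<lambda>x v. b (f x) (frechet_derivative g (at x) v) +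
          b (frechet_derivative f (at x) v) (g x)"])
      (use fg Suc.IH Ck_on_SucD[OF Suc.prems(1)] Ck_on_SucD[OF Suc.prems(2)] in
        \<open>auto intro!: bounded_bilinear.FDERIV[OF assms(2)] Ck_on_add[OF assms(1)]\<close>)
qed

text \<open>By the chain rule, the derivative of \<open>f \<circ> h\<close> in a fixed direction is the sum over \<open>b \<in> B\<close> of
  the \<open>b\<close>-components of the derivative of \<open>h\<close> times the derivative of \<open>f\<close> in the direction \<open>b\<close>,
  composed with \<open>h\<close>; the induction applies to these. The expansion in the orthonormal basis \<open>B\<close> is an
  assumption because the spaces of class \<^class>\<open>euclidean_space\<close> exclude dimension 0.\<close>

lemma Ck_on_compose:
  fixes f :: "'b::real_inner \<Rightarrow> 'c::real_normed_vector"
    and h :: "'d::real_normed_vector \<Rightarrow> 'b"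
  assumes "open S" "open T" "h ` T \<subseteq> S" "finite B" "\<And>x::'b. x = (\<Sum>b\<in>B. (x \<bullet> b) *\<^sub>R b)"
    and "Ck_on k S f" "Ck_on k T h"
  shows "Ck_on k T (\<lambda>x. f (h x))"
  using assms(6,7)
proof (induction k arbitrary: f)
  case 0
  then show ?case using assms(3) continuous_on_compose2 by auto
next
  case (Suc k)
  let ?f' = "\<lambda>x v. frechet_derivative f (at x) v" and ?h' = "\<lambda>x v. frechet_derivative h (at x) v"
  note f' = Ck_on_SucD[OF Suc.prems(1)] and h' = Ck_on_SucD[OF Suc.prems(2)]
  have eq: "?f' (h x) w = (\<Sum>b\<in>B. (w \<bullet> b) *\<^sub>R ?f' (h x) b)" if "x \<in> T" for x w
  proof -
    have "linear (?f' (h x))"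
      using f'(1) that assms(3) has_derivative_linear by blast
    then show ?thesis
      using linear_sum[of "?f' (h x)" "\<lambda>b. (w \<bullet> b) *\<^sub>R b" B] assms(5)[of w]
      by (simp add: linear_scale)
  qed
  have der: "((\<lambda>x. f (h x)) has_derivative (\<lambda>v. \<Sum>b\<in>B. (?h' x v \<bullet> b) *\<^sub>R ?f' (h x) b)) (at x)"
    if "x \<in> T" for x
  proof -
    have "((\<lambda>x. f (h x)) has_derivative (\<lambda>v. ?f' (h x) (?h' x v))) (at x)"
      using has_derivative_compose[OF h'(1)[OF that] f'(1)] that assms(3) by blast
    then show ?thesis unfolding eq[OF that, symmetric] .
  qed
  show ?case
  proof (rule Ck_on_SucI[OF assms(2) der])
    fix v
    show "Ck_on k T (\<lambda>x. \<Sum>b\<in>B. (?h' x v \<bullet> b) *\<^sub>R ?f' (h x) b)"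
    proof (rule Ck_on_sum[OF assms(2)], rule Ck_on_bilinear[OF assms(2) bounded_bilinear_scaleR])
      fix b
      show "Ck_on k T (\<lambda>x. ?h' x v \<bullet> b)"
        using Ck_on_bounded_linear[OF assms(2) bounded_linear_inner_left h'(2)] .
      show "Ck_on k T (\<lambda>x. ?f' (h x) b)"
        using Suc.IH[OF f'(2) Ck_on_Suc_imp[OF Suc.prems(2)]] .
    qed
  qed simp
qed

lemma smooth_on_sum: "open S \<Longrightarrow> (\<And>i. i \<in> I \<Longrightarrow> smooth_on S (f i)) \<Longrightarrow> smooth_on S (\<lambda>x. \<Sum>i\<in>I. f i x)"
  by (simp add: smooth_on_def Ck_on_sum)

lemma smooth_on_mult: "open S \<Longrightarrow> smooth_on S f \<Longrightarrow> smooth_on S g \<Longrightarrow> smooth_on S (\<lambda>x. f x * g x :: real)"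
  by (simp add: smooth_on_def Ck_on_bilinear[OF _ bounded_bilinear_mult])

lemma smooth_on_const: "open S \<Longrightarrow> smooth_on S (\<lambda>x. k)"
  by (simp add: smooth_on_def Ck_on_const)

lemma smooth_on_cong: "open S \<Longrightarrow> (\<And>x. x \<in> S \<Longrightarrow> f x = g x) \<Longrightarrow> smooth_on S f \<Longrightarrow> smooth_on S g"
  using Ck_on_cong unfolding smooth_on_def by blast

lemma smooth_on_has_derivative:
  assumes "smooth_on S f" "x \<in> S"
  shows "(f has_derivative frechet_derivative f (at x)) (at x)"
proof -
  have "Ck_on (Suc 0) S f" using assms(1) unfolding smooth_on_def by blast
  then show ?thesis using Ck_on_SucD(1) assms(2) by blast
qed

section \<open>A smooth bump function\<close>

text \<open>The functions that equal \<open>exp (- 1 / t) / t^n\<close> for \<open>t > 0\<close> and vanish for \<open>t \<le> 0\<close>: the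
  derivative of each is a combination of two others, so all of them are smooth.\<close>

definition flat :: "nat \<Rightarrow> real \<Rightarrow> real" where
  "flat n t = (if t > 0 then exp (- inverse t) * inverse t ^ n else 0)"

lemma flat_tendsto_0: "(flat n \<longlongrightarrow> 0) (at 0)"
proof -
  have "((\<lambda>t::real. inverse t ^ n / exp (inverse t)) \<longlongrightarrow> 0) (at_right 0)"
    using filterlim_compose[OF tendsto_power_div_exp_0 filterlim_inverse_at_top_right] .
  moreover have "\<forall>\<^sub>F t in at_right 0. inverse t ^ n / exp (inverse t) = flat n t"
    by (intro eventually_at_rightI[of 0 1]) (auto simp: flat_def exp_minus divide_inverse)
  ultimately have "(flat n \<longlongrightarrow> 0) (at_right 0)"
    using tendsto_cong by force
  moreover have "\<forall>\<^sub>F t in at_left 0. 0 = flat n t"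
    by (intro eventually_at_leftI[of "-1"]) (auto simp: flat_def)
  then have "(flat n \<longlongrightarrow> 0) (at_left 0)"
    using tendsto_cong[of "\<lambda>_. 0"] by force
  ultimately show ?thesis using filterlim_split_at by blast
qed

lemma flat_deriv:
  "(flat n has_real_derivative flat (n + 2) t - real n * flat (n + 1) t) (at t)"
proof -
  consider "t > 0" | "t < 0" | "t = 0" by linarith
  then show ?thesis
  proof cases
    case 1
    have "real n * inverse t ^ (n - 1) * (inverse t)\<^sup>2 = real n * inverse t ^ (n + 1)"
      by (cases n) (simp_all add: power2_eq_square)
    then have "((\<lambda>t. exp (- inverse t) * inverse t ^ n) has_real_derivative
        flat (n + 2) t - real n * flat (n + 1) t) (at t)"
      using 1 by (auto intro!: derivative_eq_intros
          simp: flat_def algebra_simps power2_eq_square)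
    then show ?thesis
      by (rule has_field_derivative_transform_within_open[where S = "{0<..}"])
        (use 1 in \<open>auto simp: flat_def\<close>)
  next
    case 2
    have "((\<lambda>t. 0) has_real_derivative flat (n + 2) t - real n * flat (n + 1) t) (at t)"
      using 2 by (auto simp: flat_def)
    then show ?thesis
      by (rule has_field_derivative_transform_within_open[where S = "{..<0}"])
        (use 2 in \<open>auto simp: flat_def\<close>)
  next
    case 3
    have "(\<lambda>s. (flat n s - flat n 0) / (s - 0)) = flat (n + 1)"
      by (auto simp: flat_def field_simps)
    moreover have "flat m 0 = 0" for m
      by (simp add: flat_def)
    ultimately show ?thesis
      using flat_tendsto_0[of "n + 1"] 3 by (simp add: has_field_derivative_iff)
  qed
qed

lemma Ck_on_flat: "Ck_on k UNIV (flat n)"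
proof (induction k arbitrary: n)
  case 0
  then show ?case
    using DERIV_isCont[OF flat_deriv] by (simp add: continuous_on_eq_continuous_within)
next
  case (Suc k)
  show ?case
  proof (rule Ck_on_SucI)
    show "(flat n has_derivative (*) (flat (n + 2) t - real n * flat (n + 1) t)) (at t)" for t
      using flat_deriv by (simp add: has_field_derivative_def)
    have "Ck_on k UNIV (\<lambda>t. v * flat (n + 2) t + (- v * real n) * flat (n + 1) t)" for v
      by (intro Ck_on_add Ck_on_bilinear[OF _ bounded_bilinear_mult] Ck_on_const Suc) auto
    then show "Ck_on k UNIV (\<lambda>t. (flat (n + 2) t - real n * flat (n + 1) t) * v)" for v
      by (simp add: algebra_simps)
  qed simp
qed

text \<open>A smooth function that is 1 at \<open>y0\<close> and vanishes outside the ball of radius \<open>r\<close> around it, for \<open>r > 0\<close>.\<close>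

definition bump :: "'e::real_inner \<Rightarrow> real \<Rightarrow> 'e \<Rightarrow> real" where
  "bump y0 r y = flat 0 (r\<^sup>2 - (y - y0) \<bullet> (y - y0)) / flat 0 (r\<^sup>2)"

lemma Ck_on_bump: "Ck_on k UNIV (bump y0 r)"
proof -
  have i: "Ck_on k UNIV (\<lambda>y. y + - y0)"
  proof (cases k)
    case 0
    then show ?thesis by (auto intro!: continuous_intros)
  next
    case (Suc l)
    show ?thesis unfolding Suc
      by (rule Ck_on_SucI[where f' = "\<lambda>_ v. v"])
       (auto intro!: derivative_eq_intros Ck_on_const)
  qed
  have "Ck_on k UNIV (\<lambda>y. r\<^sup>2 + (-1) * ((y + - y0) \<bullet> (y + - y0)))"
    by (intro Ck_on_add Ck_on_bilinear[OF _ bounded_bilinear_mult] Ck_on_const i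
        Ck_on_bilinear[OF _ bounded_bilinear_inner]) auto
  then have "Ck_on k UNIV (\<lambda>y. flat 0 (r\<^sup>2 + (-1) * ((y + - y0) \<bullet> (y + - y0))))"
    using Ck_on_compose[where B = "{1}" and S = UNIV and T = UNIV, OF _ _ _ _ _ Ck_on_flat] by simp
  then have "Ck_on k UNIV (\<lambda>y. inverse (flat 0 (r\<^sup>2)) * flat 0 (r\<^sup>2 + (-1) * ((y + - y0) \<bullet> (y + - y0))))"
    by (intro Ck_on_bilinear[OF _ bounded_bilinear_mult] Ck_on_const) auto
  moreover have "bump y0 r =
    (\<lambda>y. inverse (flat 0 (r\<^sup>2)) * flat 0 (r\<^sup>2 + (-1) * ((y + - y0) \<bullet> (y + - y0))))"
    by (auto simp: fun_eq_iff bump_def divide_inverse_commute)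
  ultimately show ?thesis by simp
qed

lemma bump_center: "r > 0 \<Longrightarrow> bump y0 r y0 = 1"
  by (simp add: bump_def flat_def)

lemma bump_outside: "r > 0 \<Longrightarrow> y \<notin> cball y0 r \<Longrightarrow> bump y0 r y = 0"
proof -
  assume "r > 0" "y \<notin> cball y0 r"
  then have "r\<^sup>2 \<le> (norm (y - y0))\<^sup>2"
    by (intro power_mono) (auto simp: dist_norm norm_minus_commute)
  then show ?thesis by (simp add: bump_def flat_def dot_square_norm)
qed

section \<open>The torsion form in coordinates\<close>

text \<open>Throughout, \<open>k < r\<close> is the index of the odd variable \<open>\<tau>\<^sup>k\<close> and \<open>r + \<alpha>\<close> that of \<open>\<theta>\<^sub>\<alpha>\<close>, and an
  element of the fibre of E is given by the vector of the coefficients of these variables. Only the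
  indices below \<open>2 * r\<close> matter. The following map exchanges \<open>\<tau>\<^sup>\<alpha>\<close> and \<open>\<theta>\<^sub>\<alpha>\<close>.\<close>

definition dual_ix :: "nat \<Rightarrow> nat \<Rightarrow> nat" where
  "dual_ix r k = (if k < r then r + k else k - r)"

lemma sum_double: "(\<Sum>k<2 * r. f k) = (\<Sum>\<alpha><r. f \<alpha>) + (\<Sum>\<alpha><r. f (r + \<alpha>))"
  for f :: "nat \<Rightarrow> 'b::comm_monoid_add"
proof -
  have "(\<Sum>k<2 * r. f k) = (\<Sum>k\<in>{..<r}. f k) + (\<Sum>k\<in>{r..<r + r}. f k)"
    by (subst sum.union_disjoint[symmetric]) (auto intro!: sum.cong simp: mult_2)
  also have "(\<Sum>k\<in>{r..<r + r}. f k) = (\<Sum>\<alpha><r. f (r + \<alpha>))"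
    using sum.shift_bounds_nat_ivl[of f 0 r r] by (simp add: atLeast0LessThan add.commute)
  finally show ?thesis .
qed

lemma dual_ix_simps [simp]:
  "\<alpha> < r \<Longrightarrow> dual_ix r \<alpha> = r + \<alpha>" "dual_ix r (r + \<alpha>) = \<alpha>"
  by (simp_all add: dual_ix_def)

lemma dual_ix_less: "k < 2 * r \<Longrightarrow> dual_ix r k < 2 * r"
  and dual_ix_half: "k < 2 * r \<Longrightarrow> dual_ix r k < r \<longleftrightarrow> \<not> k < r"
  by (auto simp: dual_ix_def)

text \<open>The canonical symmetric bilinear form of E on coefficient vectors.\<close>

definition cpair :: "nat \<Rightarrow> (nat \<Rightarrow> real) \<Rightarrow> (nat \<Rightarrow> real) \<Rightarrow> real" where
  "cpair r u v = (\<Sum>\<alpha><r. u \<alpha> * v (r + \<alpha>) + u (r + \<alpha>) * v \<alpha>)"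

lemma cpair_dual: "cpair r u v = (\<Sum>k<2 * r. u k * v (dual_ix r k))"
  by (simp add: cpair_def sum_double sum.distrib)

lemma cpair_commute: "cpair r u v = cpair r v u"
  by (simp add: cpair_def algebra_simps)

lemma cpair_add_left: "cpair r (u + u') v = cpair r u v + cpair r u' v"
  and cpair_add_right: "cpair r u (v + v') = cpair r u v + cpair r u v'"
  and cpair_diff_left: "cpair r (u - u') v = cpair r u v - cpair r u' v"
  by (simp_all add: cpair_def sum.distrib sum_subtractf algebra_simps)

lemma cpair_uminus: "cpair r (- u) v = - cpair r u v" "cpair r u (- v) = - cpair r u v"
  by (simp_all add: cpair_def sum_negf[symmetric])

lemma cpair_sum_left: "cpair r (\<Sum>i\<in>I. f i) v = (\<Sum>i\<in>I. cpair r (f i) v)"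
proof (induction I rule: infinite_finite_induct)
  case (insert i I)
  then show ?case using cpair_add_left[of r "f i" "sum f I" v] by (simp del: plus_fun_apply add: plus_fun_def)
qed (simp_all add: cpair_def)

lemma sum_fun_apply: "(\<Sum>i\<in>I. f i) k = (\<Sum>i\<in>I. f i k)"
  for f :: "'i \<Rightarrow> 'k \<Rightarrow> 'b::comm_monoid_add"
  by (induction I rule: infinite_finite_induct) simp_all

lemma cpair_scale_left: "cpair r (\<lambda>k. t * u k) v = t * cpair r u v"
  by (simp add: cpair_def sum_distrib_left algebra_simps)

lemma cpair_cong: "(\<And>k. k < 2 * r \<Longrightarrow> u k = u' k) \<Longrightarrow> cpair r u v = cpair r u' v"
  by (auto simp: cpair_def intro!: sum.cong)

lemma cpair_nondegenerate:
  assumes "\<And>w. cpair r u w = 0" "k < 2 * r"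
  shows "u k = 0"
proof -
  have "0 = (\<Sum>j<2 * r. u j * (if dual_ix r j = dual_ix r k then 1 else 0))"
    using assms(1)[of "\<lambda>m. if m = dual_ix r k then 1 else 0"] by (simp add: cpair_dual)
  also have "\<dots> = (\<Sum>j<2 * r. if j = k then u j else 0)"
    by (intro sum.cong) (use assms(2) in \<open>auto simp: dual_ix_def split: if_splits\<close>)
  also have "\<dots> = u k"
    using assms(2) by simp
  finally show ?thesis by simp
qed

text \<open>The action on coefficient vectors of the endomorphism of E that is given by the matrix \<open>M\<close> on A
  and by minus the transpose of \<open>M\<close> on the dual of A.\<close>

definition block_mat :: "nat \<Rightarrow> (nat \<Rightarrow> nat \<Rightarrow> real) \<Rightarrow> (nat \<Rightarrow> real) \<Rightarrow> (nat \<Rightarrow> real)" where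
  "block_mat r M u = (\<lambda>k. if k < r then - (\<Sum>\<beta><r. M \<beta> k * u \<beta>)
     else if k < 2 * r then \<Sum>\<beta><r. M (k - r) \<beta> * u (r + \<beta>) else 0)"

lemma block_mat_simps:
  "\<alpha> < r \<Longrightarrow> block_mat r M u \<alpha> = - (\<Sum>\<beta><r. M \<beta> \<alpha> * u \<beta>)"
  "\<alpha> < r \<Longrightarrow> block_mat r M u (r + \<alpha>) = (\<Sum>\<beta><r. M \<alpha> \<beta> * u (r + \<beta>))"
  by (simp_all add: block_mat_def)

lemma block_mat_add: "block_mat r M (u + v) = block_mat r M u + block_mat r M v"
  by (auto simp: block_mat_def fun_eq_iff sum.distrib algebra_simps)

lemma block_mat_cong: "(\<And>k. k < 2 * r \<Longrightarrow> u k = v k) \<Longrightarrow> block_mat r M u = block_mat r M v"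
  by (auto simp: block_mat_def fun_eq_iff intro!: sum.cong)

lemma block_mat_skew: "cpair r (block_mat r M u) v = - cpair r u (block_mat r M v)"
proof -
  have "cpair r (block_mat r M u) v = (\<Sum>\<alpha><r. \<Sum>\<beta><r. M \<alpha> \<beta> * u (r + \<beta>) * v \<alpha>)
      - (\<Sum>\<alpha><r. \<Sum>\<beta><r. M \<beta> \<alpha> * u \<beta> * v (r + \<alpha>))"
    by (simp add: cpair_def block_mat_simps sum_subtractf sum_distrib_right)
  also have "\<dots> = (\<Sum>\<beta><r. \<Sum>\<alpha><r. M \<alpha> \<beta> * u (r + \<beta>) * v \<alpha>)
      - (\<Sum>\<beta><r. \<Sum>\<alpha><r. M \<beta> \<alpha> * u \<beta> * v (r + \<alpha>))"
    using sum.swap[of "\<lambda>\<alpha> \<beta>. M \<alpha> \<beta> * u (r + \<beta>) * v \<alpha>"]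
      sum.swap[of "\<lambda>\<alpha> \<beta>. M \<beta> \<alpha> * u \<beta> * v (r + \<alpha>)"] by simp
  also have "\<dots> = - cpair r u (block_mat r M v)"
    by (simp add: cpair_def block_mat_simps sum_subtractf sum_distrib_left sum.distrib sum_negf mult_ac)
  finally show ?thesis .
qed

lemma block_mat_blk:
  "\<alpha> < r \<Longrightarrow> block_mat r M (block_mat r M' u) \<alpha> = (\<Sum>\<kappa><r. (\<Sum>\<beta><r. M' \<kappa> \<beta> * M \<beta> \<alpha>) * u \<kappa>)"
  "\<alpha> < r \<Longrightarrow> block_mat r M (block_mat r M' u) (r + \<alpha>) = (\<Sum>\<kappa><r. (\<Sum>\<beta><r. M \<alpha> \<beta> * M' \<beta> \<kappa>) * u (r + \<kappa>))"
proof -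
  assume "\<alpha> < r"
  have "block_mat r M (block_mat r M' u) \<alpha> = (\<Sum>\<beta><r. \<Sum>\<kappa><r. M' \<kappa> \<beta> * M \<beta> \<alpha> * u \<kappa>)"
    using \<open>\<alpha> < r\<close> by (simp add: block_mat_simps sum_negf sum_distrib_left mult_ac)
  also have "\<dots> = (\<Sum>\<kappa><r. (\<Sum>\<beta><r. M' \<kappa> \<beta> * M \<beta> \<alpha>) * u \<kappa>)"
    by (subst sum.swap) (simp add: sum_distrib_right)
  finally show "block_mat r M (block_mat r M' u) \<alpha> = (\<Sum>\<kappa><r. (\<Sum>\<beta><r. M' \<kappa> \<beta> * M \<beta> \<alpha>) * u \<kappa>)" .
next
  assume "\<alpha> < r"
  have "block_mat r M (block_mat r M' u) (r + \<alpha>) = (\<Sum>\<beta><r. \<Sum>\<kappa><r. M \<alpha> \<beta> * M' \<beta> \<kappa> * u (r + \<kappa>))"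
    using \<open>\<alpha> < r\<close> by (simp add: block_mat_simps sum_distrib_left mult_ac)
  also have "\<dots> = (\<Sum>\<kappa><r. (\<Sum>\<beta><r. M \<alpha> \<beta> * M' \<beta> \<kappa>) * u (r + \<kappa>))"
    by (subst sum.swap) (simp add: sum_distrib_right)
  finally show "block_mat r M (block_mat r M' u) (r + \<alpha>) = (\<Sum>\<kappa><r. (\<Sum>\<beta><r. M \<alpha> \<beta> * M' \<beta> \<kappa>) * u (r + \<kappa>))" .
qed

lemma less_double_cases:
  fixes k r :: nat
  assumes "k < 2 * r"
  obtains "k < r" | \<alpha> where "\<alpha> < r" "k = r + \<alpha>"
  using assms that(2)[of "k - r"] by (cases "k < r") (auto simp: that(1))

lemma block_mat_square:
  assumes "\<And>\<alpha> \<beta>. \<alpha> < r \<Longrightarrow> \<beta> < r \<Longrightarrow> (\<Sum>\<kappa><r. M \<alpha> \<kappa> * M \<kappa> \<beta>) = (if \<alpha> = \<beta> then t else 0)"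
    and "k < 2 * r"
  shows "block_mat r M (block_mat r M u) k = t * u k"
  using assms(2)
  by (cases rule: less_double_cases)
    (simp_all add: block_mat_blk assms(1) if_distrib[of "\<lambda>x. x * _"] cong: if_cong)

lemma block_mat_anticommute:
  assumes "\<And>\<alpha> \<beta>. \<alpha> < r \<Longrightarrow> \<beta> < r \<Longrightarrow> (\<Sum>\<kappa><r. M \<alpha> \<kappa> * M' \<kappa> \<beta>) + (\<Sum>\<kappa><r. M' \<alpha> \<kappa> * M \<kappa> \<beta>) = 0"
    and "k < 2 * r"
  shows "block_mat r M (block_mat r M' u) k = - block_mat r M' (block_mat r M u) k"
proof -
  have eq: "(\<Sum>\<kappa><r. M \<alpha> \<kappa> * M' \<kappa> \<beta>) = - (\<Sum>\<kappa><r. M' \<alpha> \<kappa> * M \<kappa> \<beta>)" if "\<alpha> < r" "\<beta> < r" for \<alpha> \<beta>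
    using assms(1)[OF that] by simp
  show ?thesis
    using assms(2) by (cases rule: less_double_cases) (simp_all add: block_mat_blk eq sum_negf)
qed

text \<open>The trilinear form on the fibre of E given by the coefficients \<open>h\<close> of a cubic polynomial in the
  odd variables. The indices of \<open>h\<close> are dual to those of the arguments, since the derivative of the
  polynomial along \<open>\<theta>\<^sub>\<alpha>\<close> enters with the coefficient of \<open>\<tau>\<^sup>\<alpha>\<close> and conversely.\<close>

definition cubic :: "nat \<Rightarrow> (nat \<Rightarrow> nat \<Rightarrow> nat \<Rightarrow> real) \<Rightarrow> (nat \<Rightarrow> real) \<Rightarrow> (nat \<Rightarrow> real) \<Rightarrow>
    (nat \<Rightarrow> real) \<Rightarrow> real" where
  "cubic r h u v w = (\<Sum>j<2 * r. \<Sum>k<2 * r. \<Sum>m<2 * r.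
     u j * v k * w m * h (dual_ix r j) (dual_ix r k) (dual_ix r m))"

lemma cubic_add: "cubic r h (u + u') v w = cubic r h u v w + cubic r h u' v w"
  by (simp add: cubic_def sum.distrib algebra_simps)

lemma cubic_swap12:
  assumes "\<And>j k m. h j k m = - h k j m"
  shows "cubic r h u v w = - cubic r h v u w"
proof -
  have "cubic r h u v w = (\<Sum>k<2 * r. \<Sum>j<2 * r. \<Sum>m<2 * r.
      u j * v k * w m * h (dual_ix r j) (dual_ix r k) (dual_ix r m))"
    unfolding cubic_def by (rule sum.swap)
  also have "\<dots> = - cubic r h v u w"
    unfolding cubic_def by (subst assms) (simp add: sum_negf algebra_simps)
  finally show ?thesis .
qed

lemma cubic_swap23:
  assumes "\<And>j k m. h j k m = - h j m k"
  shows "cubic r h u v w = - cubic r h u w v"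
proof -
  have "cubic r h u v w = (\<Sum>j<2 * r. \<Sum>m<2 * r. \<Sum>k<2 * r.
      u j * v k * w m * h (dual_ix r j) (dual_ix r k) (dual_ix r m))"
    unfolding cubic_def by (intro sum.cong refl sum.swap)
  also have "\<dots> = - cubic r h u w v"
    unfolding cubic_def by (subst assms) (simp add: sum_negf algebra_simps)
  finally show ?thesis .
qed

text \<open>The bracket of two sections at a point, in terms of their coefficients \<open>u\<close>, \<open>v\<close> and the derivatives
  \<open>du i\<close>, \<open>dv i\<close> of these in the direction of the base coordinate \<open>i\<close>. The bracket is the one derived
  from the function of degree 3 with coefficients \<open>a i k\<close> at \<open>p\<^sub>i\<close> times the odd variable \<open>k\<close>, and \<open>h\<close>
  at the products of three odd variables; up to sign, \<open>cpair r u (a i)\<close> are the components of the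
  anchor of \<open>u\<close>.\<close>

definition jet_bracket :: "nat \<Rightarrow> nat \<Rightarrow> (nat \<Rightarrow> nat \<Rightarrow> real) \<Rightarrow> (nat \<Rightarrow> nat \<Rightarrow> nat \<Rightarrow> real) \<Rightarrow>
    (nat \<Rightarrow> real) \<Rightarrow> (nat \<Rightarrow> nat \<Rightarrow> real) \<Rightarrow> (nat \<Rightarrow> real) \<Rightarrow> (nat \<Rightarrow> nat \<Rightarrow> real) \<Rightarrow> (nat \<Rightarrow> real)" where
  "jet_bracket n r a h u du v dv = (\<lambda>m.
     (\<Sum>i<n. cpair r v (a i) * du i m - cpair r u (a i) * dv i m - cpair r (du i) v * a i m)
     - (\<Sum>j<2 * r. \<Sum>k<2 * r. u j * v k * h (dual_ix r j) (dual_ix r k) m))"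

lemma jet_bracket_uminus:
  "jet_bracket n r a h (- u) (\<lambda>i. - du i) v dv m = - jet_bracket n r a h u du v dv m"
  "jet_bracket n r a h u du (- v) (\<lambda>i. - dv i) m = - jet_bracket n r a h u du v dv m"
  by (simp_all add: jet_bracket_def cpair_uminus sum_negf sum_subtractf sum.distrib)

lemma cpair_jet_bracket:
  "cpair r (jet_bracket n r a h u du v dv) w =
     (\<Sum>i<n. cpair r v (a i) * cpair r (du i) w - cpair r u (a i) * cpair r (dv i) w
        - cpair r (du i) v * cpair r w (a i)) - cubic r h u v w"
proof -
  let ?d = "\<lambda>i m. cpair r v (a i) * du i m - cpair r u (a i) * dv i m - cpair r (du i) v * a i m"
  let ?c = "\<lambda>m. \<Sum>j<2 * r. \<Sum>k<2 * r. u j * v k * h (dual_ix r j) (dual_ix r k) m"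
  have "jet_bracket n r a h u du v dv = (\<Sum>i<n. ?d i) - ?c"
    by (simp add: jet_bracket_def fun_eq_iff sum_fun_apply)
  then have "cpair r (jet_bracket n r a h u du v dv) w = (\<Sum>i<n. cpair r (?d i) w) - cpair r ?c w"
    by (simp add: cpair_diff_left cpair_sum_left)
  moreover have "cpair r (?d i) w = cpair r v (a i) * cpair r (du i) w - cpair r u (a i) * cpair r (dv i) w
      - cpair r (du i) v * cpair r w (a i)" for i
    using cpair_diff_left[of r "\<lambda>m. cpair r v (a i) * du i m - cpair r u (a i) * dv i m"
        "\<lambda>m. cpair r (du i) v * a i m" w]
      cpair_diff_left[of r "\<lambda>m. cpair r v (a i) * du i m" "\<lambda>m. cpair r u (a i) * dv i m" w]
    by (simp add: fun_diff_def cpair_scale_left cpair_commute[of r "a i" w])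
  moreover have "cpair r ?c w = cubic r h u v w"
  proof -
    have "cpair r ?c w = (\<Sum>m<2 * r. w m * ?c (dual_ix r m))"
      by (subst cpair_commute) (rule cpair_dual)
    also have "\<dots> = (\<Sum>m<2 * r. \<Sum>j<2 * r. \<Sum>k<2 * r.
        u j * v k * w m * h (dual_ix r j) (dual_ix r k) (dual_ix r m))"
      by (simp add: sum_distrib_left algebra_simps)
    also have "\<dots> = (\<Sum>j<2 * r. \<Sum>m<2 * r. \<Sum>k<2 * r.
        u j * v k * w m * h (dual_ix r j) (dual_ix r k) (dual_ix r m))"
      by (rule sum.swap)
    also have "\<dots> = cubic r h u v w"
      unfolding cubic_def by (intro sum.cong refl sum.swap)
    finally show ?thesis .
  qed
  ultimately show ?thesis by simp
qed

text \<open>The torsion at \<open>u\<close>, \<open>v\<close>, paired with \<open>w\<close>, of the endomorphism \<open>J\<close> of E with block matrix \<open>M\<close>, where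
  \<open>dM i\<close> are the partial derivatives of \<open>M\<close> and the square of \<open>J\<close> is \<open>t\<close> times the identity.\<close>

definition torsion_form :: "nat \<Rightarrow> nat \<Rightarrow> (nat \<Rightarrow> nat \<Rightarrow> real) \<Rightarrow> (nat \<Rightarrow> nat \<Rightarrow> nat \<Rightarrow> real) \<Rightarrow>
    real \<Rightarrow> (nat \<Rightarrow> nat \<Rightarrow> real) \<Rightarrow> (nat \<Rightarrow> nat \<Rightarrow> nat \<Rightarrow> real) \<Rightarrow>
    (nat \<Rightarrow> real) \<Rightarrow> (nat \<Rightarrow> real) \<Rightarrow> (nat \<Rightarrow> real) \<Rightarrow> real" where
  "torsion_form n r a h t M dM u v w =
     (let J = block_mat r M; D = (\<lambda>i. block_mat r (dM i)) in
     (\<Sum>i<n. cpair r (J v) (a i) * cpair r (D i u) w - cpair r (J u) (a i) * cpair r (D i v) w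
        - cpair r (J w) (a i) * cpair r (D i u) v - cpair r w (a i) * cpair r (D i u) (J v)
        + cpair r v (a i) * cpair r (D i u) (J w) - cpair r u (a i) * cpair r (D i v) (J w))
     - (cubic r h (J u) (J v) w + cubic r h (J u) v (J w) + cubic r h u (J v) (J w) + t * cubic r h u v w))"

text \<open>The 1-jet of \<open>J u\<close> is given by the product rule. The terms of the left-hand side with
  the derivatives \<open>du\<close>, \<open>dv\<close> cancel because \<open>\<langle>J x, y\<rangle> = - \<langle>x, J y\<rangle>\<close> and
  \<open>\<langle>J x, J y\<rangle> = - t \<langle>x, y\<rangle>\<close>.\<close>

lemma jet_torsion_eq_torsion_form:
  fixes M dM and r :: nat
  defines "J \<equiv> block_mat r M" and "D \<equiv> \<lambda>i. block_mat r (dM i)"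
  assumes JJ: "\<And>u k. k < 2 * r \<Longrightarrow> J (J u) k = t * u k"
  defines "Ju \<equiv> \<lambda>u du i. D i u + J (du i)"
  shows "cpair r (jet_bracket n r a h (J u) (Ju u du) (J v) (Ju v dv)
      - J (jet_bracket n r a h (J u) (Ju u du) v dv + jet_bracket n r a h u du (J v) (Ju v dv)
           - J (jet_bracket n r a h u du v dv))) w = torsion_form n r a h t M dM u v w"
proof -
  have JJ': "cpair r (J (J x)) y = t * cpair r x y" for x y
    using cpair_cong[of r "J (J x)" "\<lambda>k. t * x k" y] JJ cpair_scale_left by simp
  have skew: "cpair r (J x) y = - cpair r x (J y)" for x y
    unfolding J_def by (rule block_mat_skew)
  have J2: "cpair r x (J (J y)) = t * cpair r x y" for x y
    using JJ'[of y x] by (simp add: cpair_commute)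
  let ?B = "jet_bracket n r a h"
  have "cpair r (?B (J u) (Ju u du) (J v) (Ju v dv)
      - J (?B (J u) (Ju u du) v dv + ?B u du (J v) (Ju v dv) - J (?B u du v dv))) w =
    cpair r (?B (J u) (Ju u du) (J v) (Ju v dv)) w + cpair r (?B (J u) (Ju u du) v dv) (J w)
    + cpair r (?B u du (J v) (Ju v dv)) (J w) + t * cpair r (?B u du v dv) w"
    by (simp add: cpair_diff_left cpair_add_left skew J2)
  also have "\<dots> = torsion_form n r a h t M dM u v w"
    unfolding cpair_jet_bracket torsion_form_def Let_def J_def[symmetric] D_def[symmetric] Ju_def
      cpair_add_left skew[of "du i" for i] skew[of "dv i" for i] J2
    by (simp add: sum.distrib[symmetric] sum_subtractf[symmetric] sum_distrib_left algebra_simps)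
  finally show ?thesis .
qed

text \<open>With \<open>J\<close> and \<open>D\<close> the endomorphisms given by \<open>M\<close> and by a derivative of \<open>M\<close>, the assumption
  \<open>J D = - D J\<close> makes the bilinear form \<open>\<langle>D x, J y\<rangle>\<close> antisymmetric.\<close>

lemma block_mat_deriv_skew:
  assumes "\<And>i u k. k < 2 * r \<Longrightarrow> block_mat r M (block_mat r (dM i) u) k =
      - block_mat r (dM i) (block_mat r M u) k"
  shows "cpair r (block_mat r (dM i) x) (block_mat r M y) =
      - cpair r (block_mat r (dM i) y) (block_mat r M x)"
proof -
  have "cpair r (block_mat r (dM i) x) (block_mat r M y) = - cpair r (block_mat r M (block_mat r (dM i) x)) y"
    using block_mat_skew by simp
  also have "\<dots> = - cpair r (\<lambda>k. -1 * block_mat r (dM i) (block_mat r M x) k) y"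
    using cpair_cong[of r "block_mat r M (block_mat r (dM i) x)"
        "\<lambda>k. -1 * block_mat r (dM i) (block_mat r M x) k" y]
      assms[of _ i x] by simp
  also have "\<dots> = cpair r (block_mat r (dM i) (block_mat r M x)) y"
    by (simp only: cpair_scale_left)
  also have "\<dots> =
      - cpair r (block_mat r (dM i) y) (block_mat r M x)"
    using block_mat_skew cpair_commute by metis
  finally show ?thesis .
qed

lemma torsion_form_swap12:
  fixes r :: nat
  assumes "\<And>j k m. h j k m = - h k j m"
    and "\<And>i u k. k < 2 * r \<Longrightarrow> block_mat r M (block_mat r (dM i) u) k =
      - block_mat r (dM i) (block_mat r M u) k"
  shows "torsion_form n r a h t M dM u v w = - torsion_form n r a h t M dM v u w"
proof -
  have \<omega>: "cpair r (block_mat r (dM i) v) u =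
      - cpair r (block_mat r (dM i) u) v" for i
    using block_mat_skew cpair_commute by metis
  have \<kappa>: "cpair r (block_mat r (dM i) v) (block_mat r M u) =
      - cpair r (block_mat r (dM i) u) (block_mat r M v)" for i
    using block_mat_deriv_skew[OF assms(2)] .
  have c: "cubic r h x y z = - cubic r h y x z" for x y z
    using assms(1) by (rule cubic_swap12)
  show ?thesis
    unfolding torsion_form_def Let_def c[of "block_mat r M v" "block_mat r M u"] c[of "block_mat r M v" u]
      c[of v "block_mat r M u"] c[of v u] \<omega> \<kappa>
    by (simp add: sum_negf[symmetric] algebra_simps)
qed

lemma torsion_form_swap23:
  assumes "\<And>j k m. h j k m = - h j m k"
    and "\<And>i u k. k < 2 * r \<Longrightarrow> block_mat r M (block_mat r (dM i) u) k =
      - block_mat r (dM i) (block_mat r M u) k"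
  shows "torsion_form n r a h t M dM u v w = - torsion_form n r a h t M dM u w v"
proof -
  have \<omega>: "cpair r (block_mat r (dM i) w) v =
      - cpair r (block_mat r (dM i) v) w" for i
    using block_mat_skew cpair_commute by metis
  have \<kappa>: "cpair r (block_mat r (dM i) w) (block_mat r M v) =
      - cpair r (block_mat r (dM i) v) (block_mat r M w)" for i
    using block_mat_deriv_skew[OF assms(2)] .
  have c: "cubic r h x y z = - cubic r h x z y" for x y z
    using assms(1) by (rule cubic_swap23)
  show ?thesis
    unfolding torsion_form_def Let_def c[of "block_mat r M u" w "block_mat r M v"]
      c[of "block_mat r M u" "block_mat r M w" v]
      c[of u "block_mat r M w" "block_mat r M v"] c[of u w v] \<omega> \<kappa>
    by (simp add: sum_negf[symmetric] algebra_simps)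
qed

lemma torsion_form_add: "torsion_form n r a h t M dM (u + u') v w =
    torsion_form n r a h t M dM u v w + torsion_form n r a h t M dM u' v w"
  unfolding torsion_form_def Let_def block_mat_add cpair_add_left cubic_add
  by (simp add: sum.distrib sum_subtractf algebra_simps)

lemma cubic_sum_coeffs: "cubic r (\<lambda>j k m. h j k m + h' j k m) u v w = cubic r h u v w + cubic r h' u v w"
  by (simp add: cubic_def sum.distrib algebra_simps)

lemma torsion_form_sum_coeffs:
  "torsion_form n r (\<lambda>i k. a i k + a' i k) (\<lambda>j k m. h j k m + h' j k m) t M dM u v w =
     torsion_form n r a h t M dM u v w + torsion_form n r a' h' t M dM u v w"
proof -
  have "cpair r x (\<lambda>k. a i k + a' i k) = cpair r x (a i) + cpair r x (a' i)" for x i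
    using cpair_add_right[of r x "a i" "a' i"] by (simp add: plus_fun_def)
  then show ?thesis
    unfolding torsion_form_def Let_def cubic_sum_coeffs
    by (simp add: sum.distrib sum_subtractf algebra_simps)
qed

lemma torsion_form_cong:
  assumes u: "\<And>k. k < 2 * r \<Longrightarrow> u k = u' k" and v: "\<And>k. k < 2 * r \<Longrightarrow> v k = v' k"
  shows "torsion_form n r a h t M dM u v w = torsion_form n r a h t M dM u' v' w"
proof -
  have b: "block_mat r L u = block_mat r L u'" "block_mat r L v = block_mat r L v'" for L
    using block_mat_cong u v by blast+
  have p: "cpair r u x = cpair r u' x" "cpair r v x = cpair r v' x" "cpair r x v = cpair r x v'" for x
    using cpair_cong[of r u u' x] cpair_cong[of r v v' x] u v by (simp_all add: cpair_commute[of r x])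
  have c: "cubic r h u x y = cubic r h u' x y" "cubic r h x v y = cubic r h x v' y" for x y
    unfolding cubic_def using u v by (auto intro!: sum.cong)
  show ?thesis
    unfolding torsion_form_def Let_def b p c ..
qed

text \<open>For \<open>b\<close> true, the vector belongs to the dual of A (only coefficients of the \<open>\<tau>\<^sup>\<alpha>\<close>); for \<open>b\<close> false,
  it belongs to A (only coefficients of the \<open>\<theta>\<^sub>\<alpha>\<close>).\<close>

definition in_half :: "nat \<Rightarrow> bool \<Rightarrow> (nat \<Rightarrow> real) \<Rightarrow> bool" where
  "in_half r b u \<longleftrightarrow> (\<forall>k<2 * r. (k < r) \<noteq> b \<longrightarrow> u k = 0)"

lemma in_half_block_mat: "in_half r b u \<Longrightarrow> in_half r b (block_mat r M u)"
  by (auto simp: in_half_def block_mat_def intro!: sum.neutral)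

lemma cpair_in_half: "in_half r b u \<Longrightarrow> in_half r b v \<Longrightarrow> cpair r u v = 0"
  by (cases b) (auto simp: in_half_def cpair_def intro!: sum.neutral)

lemma cubic_eq_0:
  assumes "\<And>j k m. \<lbrakk>j < 2 * r; k < 2 * r; m < 2 * r; h (dual_ix r j) (dual_ix r k) (dual_ix r m) \<noteq> 0\<rbrakk> \<Longrightarrow>
    u j = 0 \<or> v k = 0 \<or> w m = 0"
  shows "cubic r h u v w = 0"
  unfolding cubic_def using assms by (intro sum.neutral ballI) fastforce

text \<open>For \<open>b\<close> true this concerns functions of the type of \<open>\<mu>\<close>, which contain one \<open>\<tau>\<close> and one \<open>p\<close> or two
  \<open>\<tau>\<close> and one \<open>\<theta>\<close>; for \<open>b\<close> false, functions of the type of \<open>\<gamma>\<close>. The torsion form vanishes for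
  reasons of degree if two arguments are in the half \<open>b\<close>, or if all three are in the other half. In the
  remaining case, antisymmetry moves the argument in the half \<open>b\<close> to the last place.\<close>

lemma torsion_form_eq_0:
  fixes M dM h a t and r n :: nat
  defines "\<tau> \<equiv> torsion_form n r a h t M dM"
  assumes h12: "\<And>j k m. h j k m = - h k j m" and h23: "\<And>j k m. h j k m = - h j m k"
    and MdM: "\<And>i u k. k < 2 * r \<Longrightarrow> block_mat r M (block_mat r (dM i) u) k =
      - block_mat r (dM i) (block_mat r M u) k"
    and a: "\<And>i. in_half r b (a i)"
    and h: "\<And>j k m. h j k m \<noteq> 0 \<Longrightarrow>
      of_bool ((j < r) = b) + of_bool ((k < r) = b) + of_bool ((m < r) = b) = (2 :: nat)"
    and base: "\<And>u v w. in_half r (\<not> b) u \<Longrightarrow> in_half r (\<not> b) v \<Longrightarrow> in_half r b w \<Longrightarrow> \<tau> u v w = 0"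
  shows "\<tau> u v w = 0"
proof -
  have 1: "\<tau> u v w = - \<tau> v u w" for u v w
    unfolding \<tau>_def using h12 MdM by (rule torsion_form_swap12)
  have 2: "\<tau> u v w = - \<tau> u w v" for u v w
    unfolding \<tau>_def using h23 MdM by (rule torsion_form_swap23)
  have three: "\<tau> u v w = 0" if "in_half r (\<not> b) u" "in_half r (\<not> b) v" "in_half r (\<not> b) w" for u v w
  proof -
    have "cubic r h x y z = 0" if "in_half r (\<not> b) x" "in_half r (\<not> b) y" "in_half r (\<not> b) z" for x y z
    proof (rule cubic_eq_0)
      fix j k m assume *: "j < 2 * r" "k < 2 * r" "m < 2 * r" "h (dual_ix r j) (dual_ix r k) (dual_ix r m) \<noteq> 0"
      then have "(j < r) = b \<or> (k < r) = b \<or> (m < r) = b"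
        using h[OF *(4)] by (cases b) (auto simp: dual_ix_half of_bool_def split: if_splits)
      then show "x j = 0 \<or> y k = 0 \<or> z m = 0"
        using that * by (auto simp: in_half_def)
    qed
    then show ?thesis
      unfolding \<tau>_def torsion_form_def Let_def
      using that by (simp add: in_half_block_mat cpair_in_half[of r "\<not> b"])
  qed
  have two: "\<tau> u v w = 0" if uv: "in_half r b u" "in_half r b v" for u v w
  proof -
    have "cubic r h x y z = 0" if "in_half r b x" "in_half r b y" for x y z
    proof (rule cubic_eq_0)
      fix j k m assume *: "j < 2 * r" "k < 2 * r" "m < 2 * r" "h (dual_ix r j) (dual_ix r k) (dual_ix r m) \<noteq> 0"
      then have "(j < r) \<noteq> b \<or> (k < r) \<noteq> b"
        using h[OF *(4)] by (cases b) (auto simp: dual_ix_half of_bool_def split: if_splits)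
      then show "x j = 0 \<or> y k = 0 \<or> z m = 0"
        using that * by (auto simp: in_half_def)
    qed
    then show ?thesis
      unfolding \<tau>_def torsion_form_def Let_def
      using uv a by (simp add: in_half_block_mat cpair_in_half[of r b])
  qed
  \<comment> \<open>Components of a vector in the half \<open>b\<close> and in the other half.\<close>
  define p q where "p u = (\<lambda>k. if (k < r) = b then u k else 0)"
    and "q u = (\<lambda>k. if (k < r) = b then 0 else u k)" for u :: "nat \<Rightarrow> real"
  have split: "u = p u + q u" for u
    by (auto simp: p_def q_def)
  have pq: "in_half r b (p u)" "in_half r (\<not> b) (q u)" for u
    by (auto simp: in_half_def p_def q_def)
  have add1: "\<tau> u v w = \<tau> (p u) v w + \<tau> (q u) v w" for u v w
    using torsion_form_add[of n r a h t M dM "p u" "q u" v w] unfolding split[symmetric] \<tau>_def .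
  have add2: "\<tau> u v w = \<tau> u (p v) w + \<tau> u (q v) w" for u v w
    using 1[of u v w] 1[of u "p v" w] 1[of u "q v" w] add1[of v u w] by linarith
  have add3: "\<tau> u v w = \<tau> u v (p w) + \<tau> u v (q w)" for u v w
    using 2[of u v w] 2[of u v "p w"] 2[of u v "q w"] add2[of u w v] by linarith
  have qq: "\<tau> (q u) (q v) w = 0" for u v w
    using add3[of "q u" "q v" w] base[OF pq(2)[of u] pq(2)[of v] pq(1)[of w]]
      three[OF pq(2)[of u] pq(2)[of v] pq(2)[of w]] by linarith
  have "\<tau> (q u) (p v) w = 0" for u v w
  proof -
    have "\<tau> (q u) (p v) (q w) = 0"
      using 2[of "q u" "p v" "q w"] qq[of u w "p v"] by linarith
    moreover have "\<tau> (q u) (p v) (p w) = 0"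
      using 1[of "q u" "p v" "p w"] 2[of "p v" "q u" "p w"] 
        two[OF pq(1)[of v] pq(1)[of w]] by simp
    ultimately show ?thesis
      using add3[of "q u" "p v" w] by linarith
  qed
  then have "\<tau> (q u) (p v) w = 0" "\<tau> (p u) (q v) w = 0"
    using 1[of "p u" "q v" w] by simp_all
  moreover have "\<tau> (p u) (p v) w = 0"
    using two pq by blast
  ultimately show ?thesis
    using add1[of u v w] add2[of "p u" v w] add2[of "q u" v w] qq[of u v w] by linarith
qed

section \<open>The derived bracket in coordinates\<close>

text \<open>Coefficients of the section \<open>u\<close> of E at the point \<open>x\<close> in the chart \<open>c\<close>.\<close>

definition ecoef :: "('m, 'a, 'e) vbundle \<Rightarrow> ('m, 'a, 'e) vb_chart \<Rightarrow> ('m, 'a) esection \<Rightarrow> 'm \<Rightarrow>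
    nat \<Rightarrow> real" where
  "ecoef A c u x k = (if k < rk A then snd u (frame A c x k)
     else if k < 2 * rk A then triv c (fst u x) (k - rk A) else 0)"

text \<open>Derivative of the coefficient \<open>k\<close> in the direction of the base coordinate \<open>i\<close>.\<close>

definition ecoef_deriv :: "('m, 'a, 'e::real_inner) vbundle \<Rightarrow> ('m, 'a, 'e) vb_chart \<Rightarrow>
    ('m, 'a) esection \<Rightarrow> 'e \<Rightarrow> nat \<Rightarrow> nat \<Rightarrow> real" where
  "ecoef_deriv A c u y i k =
     frechet_derivative (\<lambda>z. ecoef A c u (cpoint c z) k) (at y) (ebasis A i)"

lemma of_esec_coef:
  "of_esec A u c y I S =
     (if I = {#} \<and> (\<exists>k<2 * rk A. S = {k}) then ecoef A c u (cpoint c y) (the_elem S) else 0)"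
proof -
  let ?r = "rk A" and ?x = "cpoint c y"
  have eq: "of_esec A u c y I S = (\<Sum>\<alpha><?r. triv c (fst u ?x) \<alpha> * (if I = {#} \<and> S = {?r + \<alpha>} then 1 else 0))
      + (\<Sum>\<alpha><?r. snd u (frame A c ?x \<alpha>) * (if I = {#} \<and> S = {\<alpha>} then 1 else 0))"
    by (simp add: of_esec_def sum_fun_apply gscale_def ovar_def sum.distrib)
  show ?thesis
  proof (cases "I = {#} \<and> (\<exists>k<2 * rk A. S = {k})")
    case False
    then show ?thesis unfolding eq by (auto intro!: sum.neutral)
  next
    case True
    then obtain k where k: "k < 2 * ?r" "S = {k}" "I = {#}" by blast
    from k(1) show ?thesis
    proof (cases rule: less_double_cases)
      case 1
      then show ?thesis unfolding eq using k
        by (simp add: ecoef_def if_distrib[of "\<lambda>x. _ * x"] cong: if_cong)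
    next
      case (2 \<alpha>)
      then show ?thesis unfolding eq using k
        by (simp add: ecoef_def if_distrib[of "\<lambda>x. _ * x"] cong: if_cong)
    qed
  qed
qed

lemma pderiv_x_of_esec:
  "pderiv_x (ebasis A i) (of_esec A u c) y I S =
     (if I = {#} \<and> (\<exists>k<2 * rk A. S = {k}) then ecoef_deriv A c u y i (the_elem S) else 0)"
proof (cases "I = {#} \<and> (\<exists>k<2 * rk A. S = {k})")
  case True
  then show ?thesis by (auto simp: pderiv_x_def of_esec_coef ecoef_deriv_def)
next
  case False
  then have "(\<lambda>z. of_esec A u c z I S) = (\<lambda>z. 0)"
    by (simp only: of_esec_coef if_not_P[OF False] if_False)
  then show ?thesis by (simp only: pderiv_x_def if_not_P[OF False]) simp
qed

lemma pderiv_p_of_esec: "pderiv_p i (of_esec A u c y) = 0"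
  by (simp add: pderiv_p_def of_esec_coef fun_eq_iff)

lemma deriv_of_esec:
  assumes "k < 2 * rk A"
  shows "right_deriv k (of_esec A u c y) I S =
      (if I = {#} \<and> S = {} then ecoef A c u (cpoint c y) k else 0)"
    and "left_deriv k (of_esec A u c y) I S =
      (if I = {#} \<and> S = {} then ecoef A c u (cpoint c y) k else 0)"
proof -
  have "(\<exists>j<2 * rk A. insert k S = {j}) \<longleftrightarrow> S = {}" if "k \<notin> S"
    using that assms by (auto simp: insert_eq_iff)
  then show "right_deriv k (of_esec A u c y) I S =
      (if I = {#} \<and> S = {} then ecoef A c u (cpoint c y) k else 0)"
    and "left_deriv k (of_esec A u c y) I S =
      (if I = {#} \<and> S = {} then ecoef A c u (cpoint c y) k else 0)"
    by (auto simp: right_deriv_def left_deriv_def of_esec_coef)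
qed

lemma gsign_empty [simp]: "gsign {} T = 1" "gsign S {} = 1"
  by (simp_all add: gsign_def)

lemma gsign_singletons: "gsign {k} {m} = (if m < k then - 1 else 1)"
proof -
  have "{(s, t). s \<in> {k} \<and> t \<in> {m} \<and> t < s} = (if m < k then {(k, m)} else {})"
    by auto
  then show ?thesis by (simp add: gsign_def)
qed

lemma gmult_0 [simp]: "gmult 0 g = 0" "gmult f 0 = 0"
  by (simp_all add: gmult_def fun_eq_iff)

lemma submultiset_empty: "{J. J \<subseteq># {#}} = {{#}}"
  by auto

lemma submultiset_single: "{J. J \<subseteq># {#i#}} = {{#}, {#i#}}"
  using mset_subset_size[of _ "{#i#}"] by (fastforce simp: subset_mset.le_less)

lemma gmult_singleton: "gmult f g {#} {m} = f {#} {} * g {#} {m} + f {#} {m} * g {#} {}"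
  by (simp add: gmult_def submultiset_empty Pow_insert)

lemma gmult_p: "gmult f g {#i#} {} = f {#} {} * g {#i#} {} + f {#i#} {} * g {#} {}"
  by (simp add: gmult_def submultiset_single)

lemma gmult_pair:
  assumes "k \<noteq> m"
  shows "gmult f g {#} {k, m} = f {#} {} * g {#} {k, m} + gsign {k} {m} * f {#} {k} * g {#} {m}
    + gsign {m} {k} * f {#} {m} * g {#} {k} + f {#} {k, m} * g {#} {}"
proof -
  have "Pow {k, m} = {{}, {k}, {m}, {k, m}}" by auto
  moreover have "{k, m} - {k} = {m}" "{k, m} - {m} = {k}" using assms by auto
  ultimately show ?thesis
    using assms by (simp add: gmult_def submultiset_empty doubleton_eq_iff)
qed

lemma lpoisson_coef:
  "lpoisson A F G y I S =
     (\<Sum>i<dimM A. gmult (pderiv_x (ebasis A i) F y) (pderiv_p i (G y)) I S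
                - gmult (pderiv_p i (F y)) (pderiv_x (ebasis A i) G y) I S) +
     (\<Sum>k<2 * rk A. gmult (right_deriv k (F y)) (left_deriv (dual_ix (rk A) k) (G y)) I S)"
  by (simp add: lpoisson_def sum_fun_apply sum_double sum.distrib)

text \<open>Coefficient of \<open>p\<^sub>i\<close> times the odd variable \<open>k\<close>.\<close>

definition anchor_coef :: "galg \<Rightarrow> nat \<Rightarrow> nat \<Rightarrow> real" where
  "anchor_coef T i k = T {#i#} {k}"

text \<open>Coefficients at the products of three odd variables, as a totally antisymmetric family. The sign is
  that of the permutation that sorts \<open>j, k, m\<close>, because the factors of a monomial are in increasing
  order.\<close>

definition bracket_coef :: "galg \<Rightarrow> nat \<Rightarrow> nat \<Rightarrow> nat \<Rightarrow> real" where
  "bracket_coef T j k m = (if j \<noteq> k \<and> j \<noteq> m \<and> k \<noteq> m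
     then (if k < j then -1 else 1) * (if m < j then -1 else 1) * (if m < k then -1 else 1) * T {#} {j, k, m}
     else 0)"

lemma bracket_coef_swap12: "bracket_coef T j k m = - bracket_coef T k j m"
  by (auto simp: bracket_coef_def insert_commute)

lemma bracket_coef_swap23: "bracket_coef T j k m = - bracket_coef T j m k"
  by (auto simp: bracket_coef_def insert_commute)

text \<open>This needs no smoothness: both sides contain the same values of \<^const>\<open>frechet_derivative\<close>.\<close>

lemma derived_bracket_coef:
  fixes A :: "('m, 'a, 'e::real_inner) vbundle"
  assumes m: "m < 2 * rk A"
  shows "derived_bracket A \<Theta> u v c y {#} {m} =
    jet_bracket (dimM A) (rk A) (anchor_coef (\<Theta> c y)) (bracket_coef (\<Theta> c y))
      (ecoef A c u (cpoint c y)) (ecoef_deriv A c u y) (ecoef A c v (cpoint c y)) (ecoef_deriv A c v y) m"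
proof -
  let ?r = "rk A" and ?n = "dimM A" and ?T = "\<Theta> c y"
  let ?d = "dual_ix ?r"
  let ?u = "ecoef A c u (cpoint c y)" and ?v = "ecoef A c v (cpoint c y)"
  let ?du = "ecoef_deriv A c u y" and ?dv = "ecoef_deriv A c v y"
  let ?a = "anchor_coef ?T" and ?h = "bracket_coef ?T"
  \<comment> \<open>The inner bracket of \<open>u\<close> and \<open>\<Theta>\<close>. As \<open>v\<close> is linear in the odd variables, only two kinds of
    coefficients of \<open>F\<close> matter: those of \<open>p\<^sub>i\<close> and those of products of two odd variables.\<close>
  define F where "F = lpoisson A (of_esec A u c) (\<Theta> c)"
  have F_p: "F y {#i#} {} = cpair ?r ?u (?a i)" for i
    by (simp add: F_def lpoisson_coef gmult_p pderiv_x_of_esec pderiv_p_of_esec deriv_of_esec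
        left_deriv_def cpair_dual anchor_coef_def)
  have F_pair: "F y {#} {k, m} = (\<Sum>i<?n. gsign {k} {m} * ?du i k * ?a i m + gsign {m} {k} * ?du i m * ?a i k)
      + (\<Sum>l<2 * ?r. ?u l * left_deriv (?d l) ?T {#} {k, m})"
    if "k < 2 * ?r" "k \<noteq> m" for k
    using that m by (simp add: F_def lpoisson_coef gmult_pair pderiv_x_of_esec pderiv_p_of_esec
        deriv_of_esec anchor_coef_def doubleton_eq_iff) (simp add: pderiv_p_def)
  have sgn: "(if k < m then -1 else 1) * left_deriv l ?T {#} {k, m} = - ?h l k m" if "k \<noteq> m" for k l
  proof -
    have "{s. (s = k \<or> s = m) \<and> s < l} = (if k < l then {k} else {}) \<union> (if m < l then {m} else {})"
      by auto
    then show ?thesis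
      using that by (auto simp: left_deriv_def bracket_coef_def)
  qed
  have R: "right_deriv k (F y) {#} {m} = (\<Sum>i<?n. ?du i m * ?a i k - ?du i k * ?a i m)
      - (\<Sum>l<2 * ?r. ?u l * ?h (?d l) k m)" if "k < 2 * ?r" for k
  proof (cases "k = m")
    case True
    then show ?thesis by (simp add: right_deriv_def bracket_coef_def)
  next
    case False
    let ?s = "if k < m then -1 else (1::real)"
    have "{s \<in> {m}. k < s} = (if k < m then {m} else {})" by auto
    then have "right_deriv k (F y) {#} {m} = ?s * F y {#} {k, m}"
      using False by (simp add: right_deriv_def)
    also have "\<dots> = (\<Sum>i<?n. ?s * gsign {k} {m} * ?du i k * ?a i m + ?s * gsign {m} {k} * ?du i m * ?a i k)
      + (\<Sum>l<2 * ?r. ?u l * (?s * left_deriv (?d l) ?T {#} {k, m}))"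
      unfolding F_pair[OF that False] distrib_left sum_distrib_left
      by (intro arg_cong2[where f = "(+)"] sum.cong refl) (simp_all add: algebra_simps)
    also have "\<dots> = (\<Sum>i<?n. ?du i m * ?a i k - ?du i k * ?a i m)
      - (\<Sum>l<2 * ?r. ?u l * ?h (?d l) k m)"
      unfolding sgn[OF False] using False
      by (auto simp: gsign_singletons sum_negf intro!: sum.cong)
    finally show ?thesis .
  qed
  have "derived_bracket A \<Theta> u v c y {#} {m} =
      (\<Sum>i<?n. - (cpair ?r ?u (?a i) * ?dv i m)) + (\<Sum>k<2 * ?r. right_deriv k (F y) {#} {m} * ?v (?d k))"
    using m by (simp add: derived_bracket_def big_bracket_def F_def[symmetric] lpoisson_coef[of A F]
        pderiv_p_of_esec gmult_singleton pderiv_x_of_esec deriv_of_esec dual_ix_less)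
      (simp add: pderiv_p_def F_p)
  also have "(\<Sum>k<2 * ?r. right_deriv k (F y) {#} {m} * ?v (?d k)) =
      (\<Sum>i<?n. cpair ?r ?v (?a i) * ?du i m - cpair ?r (?du i) ?v * ?a i m)
      - (\<Sum>j<2 * ?r. \<Sum>k<2 * ?r. ?u j * ?v k * ?h (?d j) (?d k) m)"
  proof -
    have "(\<Sum>k<2 * ?r. right_deriv k (F y) {#} {m} * ?v (?d k)) =
      (\<Sum>k<2 * ?r. (\<Sum>i<?n. (?a i k * ?v (?d k)) * ?du i m - (?du i k * ?v (?d k)) * ?a i m)
        - (\<Sum>l<2 * ?r. ?u l * ?v (?d k) * ?h (?d l) k m))"
      by (intro sum.cong refl, subst R, simp, simp only: left_diff_distrib sum_distrib_right,
          simp only: mult_ac)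
    also have "\<dots> = (\<Sum>k<2 * ?r. \<Sum>i<?n. (?a i k * ?v (?d k)) * ?du i m - (?du i k * ?v (?d k)) * ?a i m)
        - (\<Sum>k<2 * ?r. \<Sum>l<2 * ?r. ?u l * ?v (?d k) * ?h (?d l) k m)"
      by (rule sum_subtractf)
    also have "(\<Sum>k<2 * ?r. \<Sum>i<?n. (?a i k * ?v (?d k)) * ?du i m - (?du i k * ?v (?d k)) * ?a i m)
        = (\<Sum>i<?n. cpair ?r ?v (?a i) * ?du i m - cpair ?r (?du i) ?v * ?a i m)"
      by (subst sum.swap) (simp add: cpair_commute[of ?r ?v] cpair_dual[of ?r "?a _"] cpair_dual[of ?r "?du _"]
          sum_subtractf sum_distrib_right)
    also have "(\<Sum>k<2 * ?r. \<Sum>l<2 * ?r. ?u l * ?v (?d k) * ?h (?d l) k m) =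
        (\<Sum>j<2 * ?r. \<Sum>k<2 * ?r. ?u j * ?v k * ?h (?d j) (?d k) m)"
    proof -
      have "(\<Sum>k<2 * ?r. ?u j * ?v (?d k) * ?h (?d j) k m) = (\<Sum>k<2 * ?r. ?u j * ?v k * ?h (?d j) (?d k) m)" for j
        by (simp add: sum_double)
      then show ?thesis by (subst sum.swap) simp
    qed
    finally show ?thesis .
  qed
  finally show ?thesis
    by (simp add: jet_bracket_def sum.distrib sum_subtractf sum_negf)
qed

section \<open>Charts and fibres of a vector bundle\<close>

context
  fixes A :: "('m::{t2_space,second_countable_topology}, 'a, 'e::real_inner) vbundle"
  assumes vb: "vector_bundle A"
begin

lemma chart_homeo:
  assumes "c \<in> atlas A"
  shows "open (cdom c)" "open (cimage c)" "homeomorphism (cdom c) (cimage c) (coord c) (cpoint c)"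
  using vb assms unfolding vector_bundle_def by blast+

lemma chart_point:
  assumes "c \<in> atlas A"
  shows "x \<in> cdom c \<Longrightarrow> coord c x \<in> cimage c" "x \<in> cdom c \<Longrightarrow> cpoint c (coord c x) = x"
    "y \<in> cimage c \<Longrightarrow> cpoint c y \<in> cdom c" "y \<in> cimage c \<Longrightarrow> coord c (cpoint c y) = y"
  using chart_homeo(3)[OF assms] unfolding homeomorphism_def by blast+

lemma chart_at: "chart_at A x \<in> atlas A" "x \<in> cdom (chart_at A x)"
proof -
  have "(\<Union>c\<in>atlas A. cdom c) = UNIV"
    using vb by (simp add: vector_bundle_def)
  then have "\<exists>c. c \<in> atlas A \<and> x \<in> cdom c"
    by blast
  then have "chart_at A x \<in> atlas A \<and> x \<in> cdom (chart_at A x)"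
    unfolding chart_at_def by (rule someI_ex)
  then show "chart_at A x \<in> atlas A" "x \<in> cdom (chart_at A x)" by blast+
qed

lemma chart_transition:
  assumes "c \<in> atlas A" "d \<in> atlas A"
  shows "smooth_on (coord c ` (cdom c \<inter> cdom d)) (coord d \<circ> cpoint c)"
    "\<alpha> < rk A \<Longrightarrow> \<beta> < rk A \<Longrightarrow>
      smooth_on (coord c ` (cdom c \<inter> cdom d)) (\<lambda>y. tmat A c d (cpoint c y) \<alpha> \<beta>)"
  using vb assms by (simp_all add: vector_bundle_def)

lemma open_coord_image:
  assumes "c \<in> atlas A" "open W" "W \<subseteq> cdom c"
  shows "open (coord c ` W)"
proof -
  have "coord c ` W = cimage c \<inter> cpoint c -` W"
    using chart_point[OF assms(1)] assms(3) by force
  moreover have "continuous_on (cimage c) (cpoint c)"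
    using chart_homeo(3)[OF assms(1)] unfolding homeomorphism_def by blast
  ultimately show ?thesis
    using continuous_open_preimage chart_homeo(2)[OF assms(1)] assms(2) by metis
qed

lemma ebasis_expand:
  "x = (\<Sum>b\<in>ebasis A ` {..<dimM A}. (x \<bullet> b) *\<^sub>R b)"
proof -
  let ?B = "ebasis A ` {..<dimM A}"
  have on: "ebasis A i \<bullet> ebasis A j = (if i = j then 1 else 0)" if "i < dimM A" "j < dimM A" for i j
    using vb that by (simp add: vector_bundle_def)
  have on': "b \<bullet> b' = (if b = b' then 1 else 0)" if "b \<in> ?B" "b' \<in> ?B" for b b'
    using that on by auto
  have "x \<in> span ?B"
    using vb by (simp add: vector_bundle_def)
  then obtain u where u: "x = (\<Sum>b\<in>?B. u b *\<^sub>R b)"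
    using span_finite[of ?B] by auto
  have "x \<bullet> b = u b" if "b \<in> ?B" for b
  proof -
    have "x \<bullet> b = (\<Sum>b'\<in>?B. u b' * (if b' = b then 1 else 0))"
      unfolding u inner_sum_left using on' that by (intro sum.cong) auto
    then show ?thesis using that by (simp add: if_distrib[of "\<lambda>x. _ * x"] cong: if_cong)
  qed
  then show ?thesis using u by simp
qed

lemma smooth_on_compose:
  fixes f :: "'e \<Rightarrow> 'f::real_normed_vector"
  assumes "open S" "open T" "h ` T \<subseteq> S" "smooth_on S f" "smooth_on T h"
  shows "smooth_on T (\<lambda>x. f (h x))"
  using assms(4,5) Ck_on_compose[OF assms(1-3) _ ebasis_expand] by (auto simp: smooth_on_def)

text \<open>The model space of the base need not be of class \<^class>\<open>heine_borel\<close>; a ball is compact because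
  its points have bounded coordinates in the finite orthonormal basis.\<close>

lemma compact_cball_model: "compact (cball (y :: 'e) \<rho>)"
proof -
  have K: "compact {\<Sum>b\<in>B. t b *\<^sub>R b | t. \<forall>b\<in>B. \<bar>t b\<bar> \<le> R}" if "finite B" for B :: "'e set" and R :: real
    using that
  proof (induction B rule: finite_induct)
    case (insert b B)
    have "{\<Sum>b\<in>insert b B. t b *\<^sub>R b | t. \<forall>b\<in>insert b B. \<bar>t b\<bar> \<le> R} =
      {x + z | x z. x \<in> (\<lambda>s. s *\<^sub>R b) ` {-R..R} \<and> z \<in> {\<Sum>b\<in>B. t b *\<^sub>R b | t. \<forall>b\<in>B. \<bar>t b\<bar> \<le> R}}"
      (is "?L = ?R")
    proof (intro subset_antisym subsetI)
      fix v assume "v \<in> ?L"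
      then obtain t where "v = t b *\<^sub>R b + (\<Sum>b\<in>B. t b *\<^sub>R b)" "\<forall>b\<in>insert b B. \<bar>t b\<bar> \<le> R"
        using insert.hyps by auto
      then show "v \<in> ?R" by (fastforce simp: abs_le_iff)
    next
      fix v assume "v \<in> ?R"
      then obtain s t where st: "v = s *\<^sub>R b + (\<Sum>b\<in>B. t b *\<^sub>R b)" "\<bar>s\<bar> \<le> R" "\<forall>b\<in>B. \<bar>t b\<bar> \<le> R"
        by (auto simp: abs_le_iff)
      moreover have "(\<Sum>b'\<in>B. (t(b := s)) b' *\<^sub>R b') = (\<Sum>b\<in>B. t b *\<^sub>R b)"
        using insert.hyps by (intro sum.cong) auto
      ultimately have "v = (\<Sum>b'\<in>insert b B. (t(b := s)) b' *\<^sub>R b')" "\<forall>b'\<in>insert b B. \<bar>(t(b := s)) b'\<bar> \<le> R"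
        using insert.hyps by auto
      then show "v \<in> ?L" by blast
    qed
    moreover have "compact ?R"
      by (intro compact_sums insert.IH compact_continuous_image continuous_intros) simp
    ultimately show ?case by simp
  qed simp
  let ?B = "ebasis A ` {..<dimM A}"
  let ?K = "{\<Sum>b\<in>?B. t b *\<^sub>R b | t. \<forall>b\<in>?B. \<bar>t b\<bar> \<le> norm y + \<rho>}"
  have "cball y \<rho> \<subseteq> ?K"
  proof
    fix x assume "x \<in> cball y \<rho>"
    then have "norm x \<le> norm y + \<rho>"
      using norm_triangle_ineq2[of x y] by (simp add: dist_norm norm_minus_commute)
    moreover have "norm b = 1" if "b \<in> ?B" for b
      using vb that unfolding vector_bundle_def norm_eq_1 by auto
    then have "\<bar>x \<bullet> b\<bar> \<le> norm x" if "b \<in> ?B" for b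
      using Cauchy_Schwarz_ineq2[of x b] that by simp
    ultimately have "\<forall>b\<in>?B. \<bar>x \<bullet> b\<bar> \<le> norm y + \<rho>" by fastforce
    then show "x \<in> ?K" using ebasis_expand[of x] by blast
  qed
  then show ?thesis
    using compact_Int_closed[OF K[of ?B "norm y + \<rho>"], of "cball y \<rho>"] by (simp add: Int_absorb1)
qed

lemma triv_bij:
  assumes "c \<in> atlas A" "x \<in> cdom c"
  shows "bij_betw (triv c) (fibre A x) {v. \<forall>\<alpha>\<ge>rk A. v \<alpha> = 0}"
  using vb assms unfolding vector_bundle_def by blast

lemma fibre_closed:
  "fzero A x \<in> fibre A x"
  "a \<in> fibre A x \<Longrightarrow> b \<in> fibre A x \<Longrightarrow> fadd A a b \<in> fibre A x"
  "a \<in> fibre A x \<Longrightarrow> fscale A t a \<in> fibre A x"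
  using vb unfolding vector_bundle_def by blast+

lemma triv_linear:
  assumes "c \<in> atlas A" "x \<in> cdom c"
  shows "triv c (fzero A x) = (\<lambda>\<alpha>. 0)"
    "a \<in> fibre A x \<Longrightarrow> b \<in> fibre A x \<Longrightarrow> triv c (fadd A a b) = (\<lambda>\<alpha>. triv c a \<alpha> + triv c b \<alpha>)"
    "a \<in> fibre A x \<Longrightarrow> triv c (fscale A t a) = (\<lambda>\<alpha>. t * triv c a \<alpha>)"
  using vb assms unfolding vector_bundle_def by blast+

lemma triv_above:
  assumes "c \<in> atlas A" "x \<in> cdom c" "a \<in> fibre A x" "\<alpha> \<ge> rk A"
  shows "triv c a \<alpha> = 0"
  using bij_betwE[OF triv_bij[OF assms(1,2)]] assms(3,4) by blast

lemma triv_eqI: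
  assumes "c \<in> atlas A" "x \<in> cdom c" "a \<in> fibre A x" "b \<in> fibre A x"
    and "\<And>\<alpha>. \<alpha> < rk A \<Longrightarrow> triv c a \<alpha> = triv c b \<alpha>"
  shows "a = b"
proof -
  have "triv c a = triv c b"
    using triv_above[OF assms(1,2)] assms(3-5) by (metis ext not_less)
  then show ?thesis
    using triv_bij[OF assms(1,2)] assms(3,4) unfolding bij_betw_def inj_on_def by blast
qed

lemma triv_inv:
  assumes "c \<in> atlas A" "x \<in> cdom c" "\<And>\<alpha>. \<alpha> \<ge> rk A \<Longrightarrow> v \<alpha> = 0"
  shows "inv_into (fibre A x) (triv c) v \<in> fibre A x"
    "triv c (inv_into (fibre A x) (triv c) v) = v"
proof -
  have "v \<in> triv c ` fibre A x"
    using triv_bij[OF assms(1,2)] assms(3) unfolding bij_betw_def by blast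
  then show "inv_into (fibre A x) (triv c) v \<in> fibre A x"
    "triv c (inv_into (fibre A x) (triv c) v) = v"
    by (auto intro: inv_into_into f_inv_into_f)
qed

lemma frame_props:
  assumes "c \<in> atlas A" "x \<in> cdom c" "\<alpha> < rk A"
  shows "frame A c x \<alpha> \<in> fibre A x" "triv c (frame A c x \<alpha>) \<beta> = (if \<beta> = \<alpha> then 1 else 0)"
  using triv_inv[OF assms(1,2), of "\<lambda>\<beta>. if \<beta> = \<alpha> then 1 else 0"] assms(3)
  by (auto simp: frame_def)

lemma fibre_expand:
  fixes L :: "'a \<Rightarrow> real"
  assumes c: "c \<in> atlas A" "x \<in> cdom c"
    and add: "\<And>a b. a \<in> fibre A x \<Longrightarrow> b \<in> fibre A x \<Longrightarrow> L (fadd A a b) = L a + L b"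
    and scale: "\<And>a t. a \<in> fibre A x \<Longrightarrow> L (fscale A t a) = t * L a"
    and a: "a \<in> fibre A x"
  shows "L a = (\<Sum>\<beta><rk A. triv c a \<beta> * L (frame A c x \<beta>))"
proof -
  \<comment> \<open>The vector with the first \<open>k\<close> components of \<open>a\<close>.\<close>
  define p where "p k = inv_into (fibre A x) (triv c) (\<lambda>\<beta>. if \<beta> < k then triv c a \<beta> else 0)" for k
  have p: "p k \<in> fibre A x" "triv c (p k) = (\<lambda>\<beta>. if \<beta> < k then triv c a \<beta> else 0)" for k
    using triv_inv[OF c, of "\<lambda>\<beta>. if \<beta> < k then triv c a \<beta> else 0"] triv_above[OF c a]
    by (auto simp: p_def)
  have "L (p k) = (\<Sum>\<beta><k. triv c a \<beta> * L (frame A c x \<beta>))" if "k \<le> rk A" for k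
    using that
  proof (induction k)
    case 0
    have "p 0 = fscale A 0 a"
      by (rule triv_eqI[OF c]) (use p[of 0] fibre_closed a triv_linear(3)[OF c a] in auto)
    then show ?case using scale[OF a, of 0] by simp
  next
    case (Suc k)
    note f = frame_props[OF c, of k]
    have "p (Suc k) = fadd A (p k) (fscale A (triv c a k) (frame A c x k))"
      by (rule triv_eqI[OF c])
        (use p fibre_closed f Suc.prems triv_linear[OF c] in \<open>auto simp: less_Suc_eq\<close>)
    then show ?case
      using Suc add[OF p(1)] scale f(1) fibre_closed(3) by simp
  qed
  moreover have "p (rk A) = a"
    by (rule triv_eqI[OF c]) (use p[of "rk A"] a in auto)
  ultimately show ?thesis by (metis order_refl)
qed

section \<open>Extension of vectors and covectors to global sections\<close>

text \<open>The bump function of the model space, transported to the base by the chart \<open>c\<close> and extended by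
  0. It vanishes outside a compact set \<open>K\<close>, which is closed because the base is a Hausdorff space.\<close>

lemma bump_function:
  assumes c: "c \<in> atlas A" "x0 \<in> cdom c"
  obtains \<phi> K where "closed K" "K \<subseteq> cdom c" "\<phi> x0 = (1 :: real)" "\<And>x. x \<notin> K \<Longrightarrow> \<phi> x = 0"
    "\<And>d. d \<in> atlas A \<Longrightarrow> smooth_on (coord d ` (cdom c \<inter> cdom d)) (\<phi> \<circ> cpoint d)"
proof -
  let ?y = "coord c x0"
  obtain \<rho> where \<rho>: "\<rho> > 0" "cball ?y \<rho> \<subseteq> cimage c"
    using chart_homeo(2)[OF c(1)] chart_point(1)[OF c] open_contains_cball[of "cimage c"] by auto
  define K where "K = cpoint c ` cball ?y \<rho>"
  define \<phi> where "\<phi> x = (if x \<in> cdom c then bump ?y \<rho> (coord c x) else 0)" for x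
  have "continuous_on (cball ?y \<rho>) (cpoint c)"
    using homeomorphism_cont2[OF chart_homeo(3)[OF c(1)]] \<rho>(2) by (rule continuous_on_subset)
  then have "closed K"
    unfolding K_def using compact_continuous_image compact_cball_model compact_imp_closed by blast
  moreover have "K \<subseteq> cdom c"
    using chart_point(3)[OF c(1)] \<rho>(2) unfolding K_def by blast
  moreover have "\<phi> x0 = 1"
    using c(2) bump_center \<rho>(1) by (simp add: \<phi>_def)
  moreover have "\<phi> x = 0" if "x \<notin> K" for x
  proof (cases "x \<in> cdom c")
    case True
    then have "coord c x \<notin> cball ?y \<rho>"
      using that chart_point(2)[OF c(1)] unfolding K_def by (metis image_eqI)
    then show ?thesis by (simp add: \<phi>_def bump_outside[OF \<rho>(1)] del: mem_cball)
  qed (simp add: \<phi>_def)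
  moreover have "smooth_on (coord d ` (cdom c \<inter> cdom d)) (\<phi> \<circ> cpoint d)" if d: "d \<in> atlas A" for d
  proof -
    let ?W = "coord d ` (cdom c \<inter> cdom d)"
    have W: "open ?W"
      using open_coord_image[OF d] chart_homeo(1)[OF c(1)] chart_homeo(1)[OF d] by blast
    have "smooth_on ?W (coord c \<circ> cpoint d)"
      using chart_transition(1)[OF d c(1)] by (simp add: Int_commute)
    then have "smooth_on ?W (\<lambda>z. bump ?y \<rho> ((coord c \<circ> cpoint d) z))"
      using smooth_on_compose[OF open_UNIV W, of "coord c \<circ> cpoint d" "bump ?y \<rho>"] Ck_on_bump
      unfolding smooth_on_def[of UNIV] by blast
    then show ?thesis
      by (rule smooth_on_cong[OF W, rotated]) (use chart_point[OF d] in \<open>auto simp: \<phi>_def\<close>)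
  qed
  ultimately show ?thesis using that by blast
qed

lemma smooth_on_extend:
  assumes "c \<in> atlas A" "d \<in> atlas A" "closed K" "K \<subseteq> cdom c"
    and "smooth_on (coord d ` (cdom c \<inter> cdom d)) g"
    and "\<And>y. y \<in> cimage d \<Longrightarrow> cpoint d y \<notin> K \<Longrightarrow> g y = 0"
  shows "smooth_on (cimage d) g"
proof -
  let ?U = "coord d ` (cdom c \<inter> cdom d)" and ?V = "coord d ` (cdom d - K)"
  have U: "open ?U" and V: "open ?V"
    using open_coord_image[OF assms(2), of "cdom c \<inter> cdom d"]
      open_coord_image[OF assms(2), of "cdom d - K"]
      chart_homeo(1)[OF assms(1)] chart_homeo(1)[OF assms(2)] assms(3) by auto
  have "smooth_on ?V g"
  proof (rule smooth_on_cong[OF V _ smooth_on_const[OF V]])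
    fix z assume "z \<in> ?V"
    then show "0 = g z"
      using assms(6)[of z] chart_point[OF assms(2)] by auto
  qed
  moreover have "cimage d = ?U \<union> ?V"
    using assms(4) unfolding cimage_def by blast
  ultimately show ?thesis
    using assms(5) by (simp add: smooth_on_def Ck_on_Un[OF U V])
qed

lemma smooth_tmat:
  assumes "c \<in> atlas A" "d \<in> atlas A" "\<alpha> < rk A" "\<beta> < rk A"
  shows "smooth_on (coord d ` (cdom c \<inter> cdom d)) (\<lambda>y. tmat A d c (cpoint d y) \<alpha> \<beta>)"
    "smooth_on (coord d ` (cdom c \<inter> cdom d)) (\<lambda>y. tmat A c d (cpoint d y) \<alpha> \<beta>)"
proof -
  let ?U = "coord d ` (cdom c \<inter> cdom d)" and ?V = "coord c ` (cdom c \<inter> cdom d)"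
  have U: "open ?U" and V: "open ?V"
    using open_coord_image[OF assms(1), of "cdom c \<inter> cdom d"]
      open_coord_image[OF assms(2), of "cdom c \<inter> cdom d"]
      chart_homeo(1)[OF assms(1)] chart_homeo(1)[OF assms(2)] by auto
  show "smooth_on ?U (\<lambda>y. tmat A d c (cpoint d y) \<alpha> \<beta>)"
    using chart_transition(2)[OF assms(2,1,3,4)] by (simp add: Int_commute)
  have "smooth_on ?V (\<lambda>y. tmat A c d (cpoint c y) \<alpha> \<beta>)"
    using chart_transition(2)[OF assms] .
  moreover have "smooth_on ?U (coord c \<circ> cpoint d)"
    using chart_transition(1)[OF assms(2,1)] by (simp add: Int_commute)
  moreover have "(coord c \<circ> cpoint d) ` ?U \<subseteq> ?V"
    using chart_point[OF assms(2)] by auto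
  ultimately have "smooth_on ?U (\<lambda>y. tmat A c d (cpoint c ((coord c \<circ> cpoint d) y)) \<alpha> \<beta>)"
    using smooth_on_compose[OF V U, of "coord c \<circ> cpoint d" "\<lambda>y. tmat A c d (cpoint c y) \<alpha> \<beta>"]
    by blast
  then show "smooth_on ?U (\<lambda>y. tmat A c d (cpoint d y) \<alpha> \<beta>)"
    by (rule smooth_on_cong[OF U, rotated])
      (use chart_point(2)[OF assms(1)] chart_point(2)[OF assms(2)] in auto)
qed

lemma extend_vector:
  assumes a: "a \<in> fibre A x0"
  obtains X where "X \<in> sec A" "X x0 = a"
proof -
  define c where "c = chart_at A x0"
  note c = chart_at[of x0, folded c_def]
  obtain \<phi> K where K: "closed K" "K \<subseteq> cdom c" and \<phi>: "\<phi> x0 = (1 :: real)" "\<And>x. x \<notin> K \<Longrightarrow> \<phi> x = 0"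
    "\<And>d. d \<in> atlas A \<Longrightarrow> smooth_on (coord d ` (cdom c \<inter> cdom d)) (\<phi> \<circ> cpoint d)"
    by (rule bump_function[OF c], rule that)
  define X where "X x = (if x \<in> cdom c
    then inv_into (fibre A x) (triv c) (\<lambda>\<alpha>. \<phi> x * triv c a \<alpha>) else fzero A x)" for x
  have X: "X x \<in> fibre A x" "triv c (X x) = (\<lambda>\<alpha>. \<phi> x * triv c a \<alpha>)" if "x \<in> cdom c" for x
    using triv_inv[OF c(1) that, of "\<lambda>\<alpha>. \<phi> x * triv c a \<alpha>"] triv_above[OF c a] that
    by (auto simp: X_def)
  have fib: "X x \<in> fibre A x" for x
    using X(1) fibre_closed(1) by (cases "x \<in> cdom c") (auto simp: X_def)
  have zero: "X x = fzero A x" if "x \<notin> K" for x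
  proof (cases "x \<in> cdom c")
    case True
    show ?thesis
      by (rule triv_eqI[OF c(1) True fib fibre_closed(1)])
        (use X(2)[OF True] \<phi>(2)[OF that] triv_linear(1)[OF c(1) True] in auto)
  qed (simp add: X_def)
  have "smooth_on (cimage d) (\<lambda>y. triv d (X (cpoint d y)) \<alpha>)" if d: "d \<in> atlas A" "\<alpha> < rk A" for d \<alpha>
  proof (rule smooth_on_extend[OF c(1) d(1) K])
    let ?U = "coord d ` (cdom c \<inter> cdom d)"
    have U: "open ?U"
      using open_coord_image[OF d(1)] chart_homeo(1)[OF c(1)] chart_homeo(1)[OF d(1)] by blast
    have "smooth_on ?U (\<lambda>y. \<Sum>\<beta><rk A. ((\<phi> \<circ> cpoint d) y * triv c a \<beta>) * tmat A c d (cpoint d y) \<alpha> \<beta>)"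
      by (intro smooth_on_sum smooth_on_mult U \<phi>(3) d smooth_on_const smooth_tmat c) auto
    then show "smooth_on ?U (\<lambda>y. triv d (X (cpoint d y)) \<alpha>)"
    proof (rule smooth_on_cong[OF U, rotated])
      fix y assume "y \<in> ?U"
      then have y: "cpoint d y \<in> cdom c" "cpoint d y \<in> cdom d"
        using chart_point[OF d(1)] by auto
      show "(\<Sum>\<beta><rk A. ((\<phi> \<circ> cpoint d) y * triv c a \<beta>) * tmat A c d (cpoint d y) \<alpha> \<beta>) = triv d (X (cpoint d y)) \<alpha>"
        using fibre_expand[OF c(1) y(1), of "\<lambda>a. triv d a \<alpha>" "X (cpoint d y)"]
          triv_linear[OF d(1) y(2)] X[OF y(1)] by (simp add: tmat_def)
    qed
  next
    fix y assume "y \<in> cimage d" "cpoint d y \<notin> K"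
    then show "triv d (X (cpoint d y)) \<alpha> = 0"
      using zero chart_point(3)[OF d(1)] triv_linear(1)[OF d(1)] by simp
  qed
  then have "X \<in> sec A"
    using fib by (simp add: sec_def)
  moreover have "X x0 = a"
    by (rule triv_eqI[OF c]) (use fib a X(2)[OF c(2)] \<phi>(1) in auto)
  ultimately show ?thesis using that by blast
qed

lemma extend_covector:
  assumes c: "c \<in> atlas A" "x0 \<in> cdom c"
  obtains \<xi> where "\<xi> \<in> dsec A" "\<And>\<alpha>. \<alpha> < rk A \<Longrightarrow> \<xi> (frame A c x0 \<alpha>) = w \<alpha>"
proof -
  obtain \<phi> K where K: "closed K" "K \<subseteq> cdom c" and \<phi>: "\<phi> x0 = (1 :: real)" "\<And>x. x \<notin> K \<Longrightarrow> \<phi> x = 0"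
    "\<And>d. d \<in> atlas A \<Longrightarrow> smooth_on (coord d ` (cdom c \<inter> cdom d)) (\<phi> \<circ> cpoint d)"
    by (rule bump_function[OF c], rule that)
  define \<xi> where "\<xi> a = \<phi> (proj A a) * (\<Sum>\<alpha><rk A. w \<alpha> * triv c a \<alpha>)" for a
  have \<phi>0: "\<phi> x = 0" if "x \<notin> cdom c" for x
    using \<phi>(2) K(2) that by blast
  have proj: "proj A a = x" if "a \<in> fibre A x" for a x
    using that by (simp add: fibre_def)
  have "\<xi> (fadd A a b) = \<xi> a + \<xi> b" if "a \<in> fibre A x" "b \<in> fibre A x" for x a b
    using that fibre_closed(2)[OF that] triv_linear(2)[OF c(1) _ that] \<phi>0[of x]
    by (cases "x \<in> cdom c") (auto simp: \<xi>_def proj sum.distrib algebra_simps)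
  moreover have "\<xi> (fscale A t a) = t * \<xi> a" for t a
  proof -
    have a: "a \<in> fibre A (proj A a)" by (simp add: fibre_def)
    show ?thesis
      using fibre_closed(3)[OF a, of t] triv_linear(3)[OF c(1) _ a, of t] \<phi>0[of "proj A a"]
      by (cases "proj A a \<in> cdom c") (auto simp: \<xi>_def proj sum_distrib_left mult_ac)
  qed
  moreover have "smooth_on (cimage d) (\<lambda>y. \<xi> (frame A d (cpoint d y) \<alpha>))" if d: "d \<in> atlas A" "\<alpha> < rk A" for d \<alpha>
  proof (rule smooth_on_extend[OF c(1) d(1) K])
    let ?U = "coord d ` (cdom c \<inter> cdom d)"
    have U: "open ?U"
      using open_coord_image[OF d(1)] chart_homeo(1)[OF c(1)] chart_homeo(1)[OF d(1)] by blast
    have "smooth_on ?U (\<lambda>y. (\<phi> \<circ> cpoint d) y * (\<Sum>\<beta><rk A. w \<beta> * tmat A d c (cpoint d y) \<beta> \<alpha>))"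
      by (intro smooth_on_sum smooth_on_mult U \<phi>(3) d smooth_on_const smooth_tmat c) auto
    then show "smooth_on ?U (\<lambda>y. \<xi> (frame A d (cpoint d y) \<alpha>))"
      by (rule smooth_on_cong[OF U, rotated])
        (use chart_point[OF d(1)] proj[OF frame_props(1)[OF d(1) _ d(2)]] in \<open>auto simp: \<xi>_def tmat_def\<close>)
  next
    fix y assume "y \<in> cimage d" "cpoint d y \<notin> K"
    then show "\<xi> (frame A d (cpoint d y) \<alpha>) = 0"
      using proj[OF frame_props(1)[OF d(1) _ d(2)]] chart_point(3)[OF d(1)] \<phi>(2) by (simp add: \<xi>_def)
  qed
  ultimately have "\<xi> \<in> dsec A"
    by (auto simp: dsec_def)
  moreover have "\<xi> (frame A c x0 \<alpha>) = w \<alpha>" if "\<alpha> < rk A" for \<alpha>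
    using frame_props[OF c that] that \<phi>(1)
    by (simp add: \<xi>_def proj if_distrib[of "\<lambda>x. _ * x"] cong: if_cong)
  ultimately show ?thesis using that by blast
qed

section \<open>Coefficients of sections and of their brackets\<close>

lemma esec_sec: "u \<in> esec A \<Longrightarrow> fst u \<in> sec A" and esec_dsec: "u \<in> esec A \<Longrightarrow> snd u \<in> dsec A"
  by (auto simp: esec_def)

text \<open>The value of \<open>u\<close> at \<open>x\<close> is an element of the fibre of E: a vector in the fibre of A together with a
  linear functional on this fibre. Smoothness is not required, so that brackets of sections are covered
  without a proof that they are smooth.\<close>

definition lin_at :: "'m \<Rightarrow> ('m, 'a) esection \<Rightarrow> bool" where
  "lin_at x u \<longleftrightarrow> fst u x \<in> fibre A x \<and>
     (\<forall>a\<in>fibre A x. \<forall>b\<in>fibre A x. snd u (fadd A a b) = snd u a + snd u b) \<and>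
     (\<forall>a\<in>fibre A x. \<forall>t. snd u (fscale A t a) = t * snd u a)"

lemma lin_at_esec: "u \<in> esec A \<Longrightarrow> lin_at x u"
  by (auto simp: lin_at_def esec_def sec_def dsec_def)

lemma lin_at_expand:
  assumes "c \<in> atlas A" "x \<in> cdom c" "lin_at x u" "a \<in> fibre A x"
  shows "snd u a = (\<Sum>\<beta><rk A. triv c a \<beta> * snd u (frame A c x \<beta>))"
  using assms by (intro fibre_expand) (auto simp: lin_at_def)

lemma lin_at_zero:
  assumes c: "c \<in> atlas A" "x \<in> cdom c" and u: "lin_at x u"
    and 0: "\<And>k. k < 2 * rk A \<Longrightarrow> ecoef A c u x k = 0"
  shows "fst u x = fzero A x" "a \<in> fibre A x \<Longrightarrow> snd u a = 0"
proof -
  show "fst u x = fzero A x"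
  proof (rule triv_eqI[OF c])
    fix \<alpha> assume "\<alpha> < rk A"
    then show "triv c (fst u x) \<alpha> = triv c (fzero A x) \<alpha>"
      using 0[of "rk A + \<alpha>"] triv_linear(1)[OF c] by (simp add: ecoef_def)
  qed (use u fibre_closed in \<open>auto simp: lin_at_def\<close>)
  show "snd u a = 0" if "a \<in> fibre A x"
  proof -
    have "snd u (frame A c x \<beta>) = 0" if "\<beta> < rk A" for \<beta>
      using 0[of \<beta>] that by (simp add: ecoef_def)
    then show ?thesis
      unfolding lin_at_expand[OF c u that] by simp
  qed
qed

lemma lin_at_add: "lin_at x u \<Longrightarrow> lin_at x v \<Longrightarrow> lin_at x (eadd A u v)"
  using fibre_closed by (auto simp: lin_at_def eadd_def sadd_def algebra_simps)

lemma lin_at_sub: "lin_at x u \<Longrightarrow> lin_at x v \<Longrightarrow> lin_at x (esub A u v)"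
  using fibre_closed by (auto simp: lin_at_def esub_def ssub_def sadd_def smul_def algebra_simps)

lemma ecoef_add:
  assumes "c \<in> atlas A" "x \<in> cdom c" "lin_at x u" "lin_at x v"
  shows "ecoef A c (eadd A u v) x = ecoef A c u x + ecoef A c v x"
  using triv_linear[OF assms(1,2)] assms(3,4)
  by (auto simp: lin_at_def ecoef_def eadd_def sadd_def)

lemma ecoef_sub:
  assumes "c \<in> atlas A" "x \<in> cdom c" "lin_at x u" "lin_at x v"
  shows "ecoef A c (esub A u v) x = ecoef A c u x - ecoef A c v x"
  using triv_linear[OF assms(1,2)] assms(3,4) fibre_closed
  by (auto simp: lin_at_def ecoef_def esub_def ssub_def sadd_def smul_def)

text \<open>In the chart that is used to identify functions of degree 1 with sections, the identification is the
  expected one on coefficients, for an arbitrary family of local expressions.\<close>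

lemma to_esec_at:
  fixes F x
  defines "c \<equiv> chart_at A x"
  shows "lin_at x (to_esec A F)"
    "k < 2 * rk A \<Longrightarrow> ecoef A c (to_esec A F) x k = F c (coord c x) {#} {k}"
proof -
  note c = chart_at[of x, folded c_def]
  let ?v = "\<lambda>\<alpha>. if \<alpha> < rk A then F c (coord c x) {#} {rk A + \<alpha>} else 0"
  have s: "sec_part A F x \<in> fibre A x" "triv c (sec_part A F x) = ?v"
    unfolding sec_part_def Let_def c_def[symmetric] using triv_inv[OF c, of ?v] by simp_all
  have d: "dsec_part A F a = (\<Sum>\<alpha><rk A. F c (coord c x) {#} {\<alpha>} * triv c a \<alpha>)" if "a \<in> fibre A x" for a
    using that by (simp add: dsec_part_def Let_def c_def fibre_def)
  show "lin_at x (to_esec A F)"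
    using s(1) triv_linear[OF c] fibre_closed
    by (auto simp: lin_at_def to_esec_def d sum.distrib sum_distrib_left algebra_simps)
  show "k < 2 * rk A \<Longrightarrow> ecoef A c (to_esec A F) x k = F c (coord c x) {#} {k}"
    using s(2) frame_props[OF c]
    by (auto simp: ecoef_def to_esec_def d if_distrib[of "\<lambda>x. _ * x"] cong: if_cong)
qed

lemma smooth_ecoef:
  assumes "u \<in> esec A" "c \<in> atlas A"
  shows "smooth_on (cimage c) (\<lambda>y. ecoef A c u (cpoint c y) k)"
proof -
  consider "k < rk A" | "\<not> k < rk A" "k < 2 * rk A" | "\<not> k < 2 * rk A" by blast
  then show ?thesis
  proof cases
    case 1
    then show ?thesis
      using esec_dsec[OF assms(1)] assms(2) by (simp add: ecoef_def dsec_def)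
  next
    case 2
    then have "k - rk A < rk A" by simp
    then show ?thesis
      using esec_sec[OF assms(1)] assms(2) 2 by (simp add: ecoef_def sec_def)
  next
    case 3
    then show ?thesis
      using smooth_on_const[OF chart_homeo(2)[OF assms(2)], of 0] by (simp add: ecoef_def)
  qed
qed

lemma ecoef_deriv_eqI:
  assumes "c \<in> atlas A" "y \<in> cimage c"
    and "\<And>z. z \<in> cimage c \<Longrightarrow> ecoef A c u (cpoint c z) k = g z"
    and "(g has_derivative g') (at y)"
  shows "ecoef_deriv A c u y i k = g' (ebasis A i)"
proof -
  have "((\<lambda>z. ecoef A c u (cpoint c z) k) has_derivative g') (at y)"
    using has_derivative_transform_within_open[OF assms(4) chart_homeo(2)[OF assms(1)] assms(2)]
      assms(3) by simp
  then show ?thesis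
    unfolding ecoef_deriv_def by (simp add: frechet_derivative_at[symmetric])
qed

lemma ecoef_has_derivative:
  assumes "u \<in> esec A" "c \<in> atlas A" "y \<in> cimage c"
  shows "((\<lambda>z. ecoef A c u (cpoint c z) k) has_derivative
    frechet_derivative (\<lambda>z. ecoef A c u (cpoint c z) k) (at y)) (at y)"
  using smooth_on_has_derivative[OF smooth_ecoef[OF assms(1,2)] assms(3)] .

lemma dorfman_at:
  fixes x
  defines "c \<equiv> chart_at A x"
  shows "lin_at x (dorfman A \<Theta> u v)"
    "k < 2 * rk A \<Longrightarrow> ecoef A c (dorfman A \<Theta> u v) x k =
       jet_bracket (dimM A) (rk A) (anchor_coef (\<Theta> c (coord c x))) (bracket_coef (\<Theta> c (coord c x)))
         (ecoef A c u x) (ecoef_deriv A c u (coord c x)) (ecoef A c v x) (ecoef_deriv A c v (coord c x)) k"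
  using to_esec_at[where x = x and F = "derived_bracket A \<Theta> u v"] chart_point(2)[OF chart_at]
  by (simp_all add: dorfman_def c_def derived_bracket_coef)

lemma chart_point_at: "cpoint (chart_at A x) (coord (chart_at A x) x) = x"
    "coord (chart_at A x) x \<in> cimage (chart_at A x)"
  using chart_point[OF chart_at(1)[of x]] chart_at(2)[of x] by blast+

lemma zero_dsec: "(0 :: 'a \<Rightarrow> real) \<in> dsec A"
  by (auto simp: dsec_def intro!: smooth_on_const chart_homeo(2))

lemma fzero_sec: "fzero A \<in> sec A"
proof -
  have "smooth_on (cimage c) (\<lambda>y. triv c (fzero A (cpoint c y)) \<alpha>)" if c: "c \<in> atlas A" for c \<alpha>
    by (rule smooth_on_cong[OF chart_homeo(2)[OF c] _ smooth_on_const[OF chart_homeo(2)[OF c], of 0]])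
      (use triv_linear(1)[OF c] chart_point(3)[OF c] in simp)
  then show ?thesis
    using fibre_closed(1) by (simp add: sec_def)
qed

lemma uminus_dsec:
  assumes "\<xi> \<in> dsec A"
  shows "- \<xi> \<in> dsec A"
proof -
  have "smooth_on (cimage c) (\<lambda>y. -1 * \<xi> (frame A c (cpoint c y) \<alpha>))" if "c \<in> atlas A" "\<alpha> < rk A" for c \<alpha>
    using assms that chart_homeo(2)[OF that(1)]
    by (intro smooth_on_mult smooth_on_const) (simp_all add: dsec_def)
  then show ?thesis
    using assms by (simp add: dsec_def)
qed

lemma fscale_0:
  assumes "a \<in> fibre A x"
  shows "fscale A 0 a = fzero A x"
  by (rule triv_eqI[OF chart_at]) (use assms fibre_closed triv_linear[OF chart_at[of x]] in auto)

text \<open>The block endomorphism acts on the dual of A by minus the transpose, so the comparison of the torsions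
  of the two needs that signs can be moved out of the bracket.\<close>

lemma dual_lie_bracket_uminus:
  assumes "\<xi> \<in> dsec A" "\<eta> \<in> dsec A"
  shows "dual_lie_bracket A \<gamma> (- \<xi>) \<eta> = - dual_lie_bracket A \<gamma> \<xi> \<eta>"
    "dual_lie_bracket A \<gamma> \<xi> (- \<eta>) = - dual_lie_bracket A \<gamma> \<xi> \<eta>"
proof -
  have neg: "ecoef A c (fzero A, - \<zeta>) x = - ecoef A c (fzero A, \<zeta>) x"
    if "c \<in> atlas A" "x \<in> cdom c" for c x \<zeta>
    using triv_linear(1)[OF that] by (auto simp: ecoef_def fun_eq_iff)
  have dneg: "ecoef_deriv A c (fzero A, - \<zeta>) y = (\<lambda>i. - ecoef_deriv A c (fzero A, \<zeta>) y i)"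
    if "c \<in> atlas A" "y \<in> cimage c" "\<zeta> \<in> dsec A" for c y \<zeta>
  proof (intro ext)
    fix i k
    have \<zeta>: "(fzero A, \<zeta>) \<in> esec A"
      using fzero_sec that(3) by (simp add: esec_def)
    have "ecoef A c (fzero A, - \<zeta>) (cpoint c z) k = - ecoef A c (fzero A, \<zeta>) (cpoint c z) k"
      if "z \<in> cimage c" for z
      using neg[OF \<open>c \<in> atlas A\<close> chart_point(3)[OF \<open>c \<in> atlas A\<close> that]] by simp
    from ecoef_deriv_eqI[OF that(1,2) this has_derivative_minus[OF ecoef_has_derivative[OF \<zeta> that(1,2)]]]
    show "ecoef_deriv A c (fzero A, - \<zeta>) y i k = (- ecoef_deriv A c (fzero A, \<zeta>) y i) k"
      by (simp add: ecoef_deriv_def)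
  qed
  note simps = dual_lie_bracket_def dsec_part_def Let_def derived_bracket_coef chart_point_at
    neg[OF chart_at] dneg[OF chart_at(1) chart_point_at(2)] assms jet_bracket_uminus
  show "dual_lie_bracket A \<gamma> (- \<xi>) \<eta> = - dual_lie_bracket A \<gamma> \<xi> \<eta>"
    "dual_lie_bracket A \<gamma> \<xi> (- \<eta>) = - dual_lie_bracket A \<gamma> \<xi> \<eta>"
    by (simp_all add: fun_eq_iff simps sum_negf)
qed

section \<open>The block endomorphism in a chart\<close>

context
  fixes N :: "'a \<Rightarrow> 'a"
  assumes endo: "bundle_endo A N"
begin

text \<open>Matrix of \<open>N\<close> in the frame of the chart \<open>c\<close>.\<close>

definition nmat :: "('m, 'a, 'e) vb_chart \<Rightarrow> 'm \<Rightarrow> nat \<Rightarrow> nat \<Rightarrow> real" where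
  "nmat c x \<alpha> \<beta> = triv c (N (frame A c x \<beta>)) \<alpha>"

lemma endo_props:
  "a \<in> fibre A x \<Longrightarrow> N a \<in> fibre A x"
  "a \<in> fibre A x \<Longrightarrow> b \<in> fibre A x \<Longrightarrow> N (fadd A a b) = fadd A (N a) (N b)"
  "N (fscale A t a) = fscale A t (N a)"
  "c \<in> atlas A \<Longrightarrow> \<alpha> < rk A \<Longrightarrow> \<beta> < rk A \<Longrightarrow> smooth_on (cimage c) (\<lambda>y. nmat c (cpoint c y) \<alpha> \<beta>)"
  using endo by (auto simp: bundle_endo_def nmat_def)

lemma triv_endo:
  assumes c: "c \<in> atlas A" "x \<in> cdom c" and a: "a \<in> fibre A x"
  shows "triv c (N a) \<alpha> = (\<Sum>\<beta><rk A. nmat c x \<alpha> \<beta> * triv c a \<beta>)"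
proof -
  have "triv c (N a) \<alpha> = (\<Sum>\<beta><rk A. triv c a \<beta> * triv c (N (frame A c x \<beta>)) \<alpha>)"
    by (rule fibre_expand[OF c _ _ a, of "\<lambda>a. triv c (N a) \<alpha>"])
      (use endo_props triv_linear[OF c] in auto)
  then show ?thesis by (simp add: nmat_def mult.commute)
qed

lemma lin_at_block: "lin_at x u \<Longrightarrow> lin_at x (block_endo N u)"
  using endo_props by (auto simp: lin_at_def block_endo_def sec_endo_def transpose_endo_def)

lemma ecoef_block:
  assumes c: "c \<in> atlas A" "x \<in> cdom c" and u: "lin_at x u"
  shows "ecoef A c (block_endo N u) x = block_mat (rk A) (nmat c x) (ecoef A c u x)"
proof
  fix k
  consider "k < rk A" | "\<not> k < rk A" "k < 2 * rk A" | "\<not> k < 2 * rk A" by blast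
  then show "ecoef A c (block_endo N u) x k = block_mat (rk A) (nmat c x) (ecoef A c u x) k"
  proof cases
    case 1
    then show ?thesis
      using lin_at_expand[OF c u endo_props(1)[OF frame_props(1)[OF c 1]]]
      by (simp add: ecoef_def block_mat_def block_endo_def transpose_endo_def nmat_def)
  next
    case 2
    then show ?thesis
      using triv_endo[OF c, of "fst u x"] u
      by (simp add: ecoef_def block_mat_def block_endo_def sec_endo_def lin_at_def)
  qed (simp add: ecoef_def block_mat_def)
qed

lemma block_esec:
  assumes u: "u \<in> esec A"
  shows "block_endo N u \<in> esec A"
proof -
  have smooth: "smooth_on (cimage c) (\<lambda>y. ecoef A c (block_endo N u) (cpoint c y) k)"
    if c: "c \<in> atlas A" for c k
  proof -
    note o = chart_homeo(2)[OF c]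
    have "smooth_on (cimage c) (\<lambda>y. block_mat (rk A) (nmat c (cpoint c y)) (ecoef A c u (cpoint c y)) k)"
    proof -
      consider "k < rk A" | "\<not> k < rk A" "k < 2 * rk A" | "\<not> k < 2 * rk A" by blast
      then show ?thesis
      proof cases
        case 1
        have "smooth_on (cimage c) (\<lambda>y. -1 * (\<Sum>\<beta><rk A. nmat c (cpoint c y) \<beta> k * ecoef A c u (cpoint c y) \<beta>))"
          by (intro smooth_on_mult smooth_on_const smooth_on_sum o endo_props(4) smooth_ecoef u c 1) simp
        then show ?thesis using 1 by (simp add: block_mat_def)
      next
        case 2
        then have "k - rk A < rk A" by simp
        then have "smooth_on (cimage c) (\<lambda>y. \<Sum>\<beta><rk A. nmat c (cpoint c y) (k - rk A) \<beta> *
            ecoef A c u (cpoint c y) (rk A + \<beta>))"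
          by (intro smooth_on_mult smooth_on_sum o endo_props(4) smooth_ecoef u c) simp_all
        then show ?thesis using 2 by (simp add: block_mat_def)
      qed (simp add: block_mat_def smooth_on_const[OF o])
    qed
    then show ?thesis
      by (rule smooth_on_cong[OF o, rotated])
        (use ecoef_block[OF c chart_point(3)[OF c] lin_at_esec[OF u]] in simp)
  qed
  have "smooth_on (cimage c) (\<lambda>y. triv c (fst (block_endo N u) (cpoint c y)) \<alpha>)"
    "smooth_on (cimage c) (\<lambda>y. snd (block_endo N u) (frame A c (cpoint c y) \<alpha>))"
    if "c \<in> atlas A" "\<alpha> < rk A" for c \<alpha>
    using smooth[OF that(1), of "rk A + \<alpha>"] smooth[OF that(1), of \<alpha>] that(2)
    by (simp_all add: ecoef_def)
  moreover have "snd (block_endo N u) (fscale A t a) = t * snd (block_endo N u) a" for a t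
    using esec_dsec[OF u] endo_props(3)
    by (simp add: dsec_def block_endo_def transpose_endo_def)
  ultimately show ?thesis
    using lin_at_block[OF lin_at_esec[OF u]]
    by (cases "block_endo N u") (auto simp: esec_def sec_def dsec_def lin_at_def)
qed

text \<open>Derivative of the matrix of \<open>N\<close> in the direction of the base coordinate \<open>i\<close>.\<close>

definition dnmat :: "('m, 'a, 'e) vb_chart \<Rightarrow> 'e \<Rightarrow> nat \<Rightarrow> nat \<Rightarrow> nat \<Rightarrow> real" where
  "dnmat c y i \<alpha> \<beta> = frechet_derivative (\<lambda>z. nmat c (cpoint c z) \<alpha> \<beta>) (at y) (ebasis A i)"

lemma nmat_has_derivative:
  assumes "c \<in> atlas A" "y \<in> cimage c" "\<alpha> < rk A" "\<beta> < rk A"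
  shows "((\<lambda>z. nmat c (cpoint c z) \<alpha> \<beta>) has_derivative
    frechet_derivative (\<lambda>z. nmat c (cpoint c z) \<alpha> \<beta>) (at y)) (at y)"
  using smooth_on_has_derivative[OF endo_props(4)[OF assms(1,3,4)] assms(2)] .

lemma ecoef_deriv_block:
  assumes c: "c \<in> atlas A" and y: "y \<in> cimage c" and u: "u \<in> esec A"
  shows "ecoef_deriv A c (block_endo N u) y i = block_mat (rk A) (dnmat c y i) (ecoef A c u (cpoint c y))
    + block_mat (rk A) (nmat c (cpoint c y)) (ecoef_deriv A c u y i)"
proof
  fix k
  have eq: "ecoef A c (block_endo N u) (cpoint c z) k =
    block_mat (rk A) (nmat c (cpoint c z)) (ecoef A c u (cpoint c z)) k" if "z \<in> cimage c" for z
    using ecoef_block[OF c chart_point(3)[OF c that] lin_at_esec[OF u]] by simp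
  note dp = ecoef_has_derivative[OF u c y] and dn = nmat_has_derivative[OF c y]
  consider "k < rk A" | "\<not> k < rk A" "k < 2 * rk A" | "\<not> k < 2 * rk A" by blast
  then show "ecoef_deriv A c (block_endo N u) y i k = (block_mat (rk A) (dnmat c y i) (ecoef A c u (cpoint c y))
    + block_mat (rk A) (nmat c (cpoint c y)) (ecoef_deriv A c u y i)) k"
  proof cases
    case 1
    have "((\<lambda>z. - (\<Sum>\<beta><rk A. nmat c (cpoint c z) \<beta> k * ecoef A c u (cpoint c z) \<beta>)) has_derivative
      (\<lambda>v. - (\<Sum>\<beta><rk A. nmat c (cpoint c y) \<beta> k * frechet_derivative (\<lambda>z. ecoef A c u (cpoint c z) \<beta>) (at y) v
        + frechet_derivative (\<lambda>z. nmat c (cpoint c z) \<beta> k) (at y) v * ecoef A c u (cpoint c y) \<beta>))) (at y)"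
      by (intro has_derivative_minus has_derivative_sum has_derivative_mult dp dn 1) simp
    from ecoef_deriv_eqI[OF c y _ this] eq 1 show ?thesis
      by (simp add: block_mat_def ecoef_deriv_def dnmat_def sum.distrib)
  next
    case 2
    then have k: "k - rk A < rk A" by simp
    have "((\<lambda>z. \<Sum>\<beta><rk A. nmat c (cpoint c z) (k - rk A) \<beta> * ecoef A c u (cpoint c z) (rk A + \<beta>)) has_derivative
      (\<lambda>v. \<Sum>\<beta><rk A. nmat c (cpoint c y) (k - rk A) \<beta> *
          frechet_derivative (\<lambda>z. ecoef A c u (cpoint c z) (rk A + \<beta>)) (at y) v
        + frechet_derivative (\<lambda>z. nmat c (cpoint c z) (k - rk A) \<beta>) (at y) v *
          ecoef A c u (cpoint c y) (rk A + \<beta>))) (at y)"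
      by (intro has_derivative_sum has_derivative_mult dp dn k) simp
    from ecoef_deriv_eqI[OF c y _ this] eq 2 show ?thesis
      by (simp add: block_mat_def ecoef_deriv_def dnmat_def sum.distrib)
  next
    case 3
    then show ?thesis
      using ecoef_deriv_eqI[OF c y _ has_derivative_const[of 0]] eq by (simp add: block_mat_def)
  qed
qed

context
  fixes t :: real
  assumes square: "\<And>a. N (N a) = fscale A t a"
begin

lemma nmat_square:
  assumes c: "c \<in> atlas A" "x \<in> cdom c" and "\<alpha> < rk A" "\<beta> < rk A"
  shows "(\<Sum>\<kappa><rk A. nmat c x \<alpha> \<kappa> * nmat c x \<kappa> \<beta>) = (if \<alpha> = \<beta> then t else 0)"
proof -
  note f = frame_props[OF c \<open>\<beta> < rk A\<close>]
  have "(\<Sum>\<kappa><rk A. nmat c x \<alpha> \<kappa> * nmat c x \<kappa> \<beta>) = triv c (N (N (frame A c x \<beta>))) \<alpha>"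
    using triv_endo[OF c endo_props(1)[OF f(1)]] by (simp add: nmat_def)
  also have "\<dots> = (if \<alpha> = \<beta> then t else 0)"
    using triv_linear(3)[OF c f(1)] f(2) by (simp add: square)
  finally show ?thesis .
qed

text \<open>The derivative of \<open>N\<^sup>2 = t Id\<close>.\<close>

lemma nmat_dnmat:
  assumes c: "c \<in> atlas A" and y: "y \<in> cimage c" and "\<alpha> < rk A" "\<beta> < rk A"
  shows "(\<Sum>\<kappa><rk A. nmat c (cpoint c y) \<alpha> \<kappa> * dnmat c y i \<kappa> \<beta>)
    + (\<Sum>\<kappa><rk A. dnmat c y i \<alpha> \<kappa> * nmat c (cpoint c y) \<kappa> \<beta>) = 0"
proof -
  let ?f = "\<lambda>z. \<Sum>\<kappa><rk A. nmat c (cpoint c z) \<alpha> \<kappa> * nmat c (cpoint c z) \<kappa> \<beta>"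
  let ?f' = "\<lambda>v. \<Sum>\<kappa><rk A.
    nmat c (cpoint c y) \<alpha> \<kappa> * frechet_derivative (\<lambda>z. nmat c (cpoint c z) \<kappa> \<beta>) (at y) v
    + frechet_derivative (\<lambda>z. nmat c (cpoint c z) \<alpha> \<kappa>) (at y) v * nmat c (cpoint c y) \<kappa> \<beta>"
  have "(?f has_derivative ?f') (at y)"
    by (intro has_derivative_sum has_derivative_mult nmat_has_derivative c y assms) simp_all
  moreover have "(?f has_derivative (\<lambda>v. 0)) (at y)"
    using has_derivative_transform_within_open[OF has_derivative_const
        chart_homeo(2)[OF c] y, of "if \<alpha> = \<beta> then t else 0" ?f]
      nmat_square[OF c chart_point(3)[OF c] assms(3,4)] by simp
  ultimately have "?f' = (\<lambda>v. 0)"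
    by (rule has_derivative_unique)
  then have "?f' (ebasis A i) = 0" by meson
  then show ?thesis
    by (simp add: dnmat_def sum.distrib)
qed

lemma block_mat_nmat_square:
  assumes "c \<in> atlas A" "x \<in> cdom c" "k < 2 * rk A"
  shows "block_mat (rk A) (nmat c x) (block_mat (rk A) (nmat c x) u) k = t * u k"
  using nmat_square[OF assms(1,2)] assms(3) by (rule block_mat_square)

lemma block_mat_nmat_dnmat:
  assumes "c \<in> atlas A" "y \<in> cimage c" "k < 2 * rk A"
  shows "block_mat (rk A) (nmat c (cpoint c y)) (block_mat (rk A) (dnmat c y i) u) k =
    - block_mat (rk A) (dnmat c y i) (block_mat (rk A) (nmat c (cpoint c y)) u) k"
  using nmat_dnmat[OF assms(1,2)] assms(3) by (rule block_mat_anticommute)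

section \<open>The torsion of the block endomorphism\<close>

text \<open>Torsion of the block endomorphism for the bracket derived from \<open>\<Theta>\<close>.\<close>

definition block_torsion :: "('m, 'a, 'e) gfun \<Rightarrow> ('m, 'a) esection \<Rightarrow> ('m, 'a) esection \<Rightarrow>
    ('m, 'a) esection" where
  "block_torsion \<Theta> = torsion (eadd A) (esub A) (dorfman A \<Theta>) (block_endo N)"

lemma lin_at_torsion: "lin_at x (block_torsion \<Theta> u v)"
  unfolding block_torsion_def torsion_def
  by (intro lin_at_sub lin_at_add lin_at_block dorfman_at(1))

text \<open>The torsion form at \<open>x\<close> of the block endomorphism, for the cubic polynomial \<open>T\<close>.\<close>

abbreviation torsion_form_at :: "galg \<Rightarrow> 'm \<Rightarrow> (nat \<Rightarrow> real) \<Rightarrow> (nat \<Rightarrow> real) \<Rightarrow> (nat \<Rightarrow> real) \<Rightarrow> real" where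
  "torsion_form_at T x \<equiv> torsion_form (dimM A) (rk A) (anchor_coef T) (bracket_coef T) t
     (nmat (chart_at A x) x) (dnmat (chart_at A x) (coord (chart_at A x) x))"

lemma torsion_at:
  fixes x
  defines "c \<equiv> chart_at A x"
  assumes u: "u \<in> esec A" and v: "v \<in> esec A"
  shows "cpair (rk A) (ecoef A c (block_torsion \<Theta> u v) x) w =
    torsion_form_at (\<Theta> c (coord c x)) x (ecoef A c u x) (ecoef A c v x) w"
proof -
  note c = chart_at[of x, folded c_def]
  let ?y = "coord c x" and ?P = "block_endo N" and ?D = "dorfman A \<Theta>"
  have y: "?y \<in> cimage c" "cpoint c ?y = x"
    using chart_point_at[of x] by (simp_all add: c_def)
  let ?J = "block_mat (rk A) (nmat c x)" and ?dN = "dnmat c ?y"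
  let ?B = "jet_bracket (dimM A) (rk A) (anchor_coef (\<Theta> c ?y)) (bracket_coef (\<Theta> c ?y))"
  let ?p = "\<lambda>u. ecoef A c u x" and ?d = "\<lambda>u. ecoef_deriv A c u ?y"
  have P: "?p (?P u) = ?J (?p u)" "?d (?P u) = (\<lambda>i. block_mat (rk A) (?dN i) (?p u) + ?J (?d u i))"
    if "u \<in> esec A" for u
    using ecoef_block[OF c lin_at_esec[OF that]] ecoef_deriv_block[OF c(1) y(1) that] y(2) by auto
  have D: "?p (?D a b) k = ?B (?p a) (?d a) (?p b) (?d b) k" if "k < 2 * rk A" for a b k
    using dorfman_at(2)[OF that, of x \<Theta> a b] by (simp add: c_def)
  have "?p (block_torsion \<Theta> u v) =
      ?p (?D (?P u) (?P v)) - ?J (?p (?D (?P u) v) + ?p (?D u (?P v)) - ?J (?p (?D u v)))"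
    unfolding block_torsion_def torsion_def
    by (simp add: ecoef_sub[OF c] ecoef_add[OF c] ecoef_block[OF c] lin_at_sub lin_at_add
        lin_at_block dorfman_at(1))
  \<comment> \<open>The coefficients of the brackets agree with \<open>?B\<close> for the indices below \<open>2 * rk A\<close> only, and these
    are the only ones that enter in \<open>cpair\<close> and \<open>block_mat\<close>.\<close>
  then have "cpair (rk A) (?p (block_torsion \<Theta> u v)) w = cpair (rk A)
      (?B (?p (?P u)) (?d (?P u)) (?p (?P v)) (?d (?P v))
        - ?J (?B (?p (?P u)) (?d (?P u)) (?p v) (?d v) + ?B (?p u) (?d u) (?p (?P v)) (?d (?P v))
             - ?J (?B (?p u) (?d u) (?p v) (?d v)))) w"
    using D block_mat_cong[of "rk A" "?p (?D u v)" "?B (?p u) (?d u) (?p v) (?d v)" "nmat c x"]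
      block_mat_cong[of "rk A" "?p (?D (?P u) v) + ?p (?D u (?P v)) - ?J (?p (?D u v))"
        "?B (?p (?P u)) (?d (?P u)) (?p v) (?d v) + ?B (?p u) (?d u) (?p (?P v)) (?d (?P v))
             - ?J (?B (?p u) (?d u) (?p v) (?d v))" "nmat c x"]
    by (intro cpair_cong) simp
  also have "\<dots> = torsion_form_at (\<Theta> c ?y) x (?p u) (?p v) w"
    unfolding P[OF u] P[OF v]
    using jet_torsion_eq_torsion_form[where M = "nmat c x" and dM = ?dN and t = t, OF block_mat_nmat_square[OF c]]
    by (simp add: c_def)
  finally show ?thesis .
qed

lemma torsion_form_at_eq_0:
  fixes b
  assumes a: "\<And>i k. k < 2 * rk A \<Longrightarrow> T {#i#} {k} \<noteq> 0 \<Longrightarrow> (k < rk A) = b"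
    and h: "\<And>S. T {#} S \<noteq> 0 \<Longrightarrow> (\<Sum>k\<in>S. of_bool ((k < rk A) = b)) = (2 :: nat)"
    and base: "\<And>u v w. in_half (rk A) (\<not> b) u \<Longrightarrow> in_half (rk A) (\<not> b) v \<Longrightarrow>
      in_half (rk A) b w \<Longrightarrow> torsion_form_at T x u v w = 0"
  shows "torsion_form_at T x u v w = 0"
proof (rule torsion_form_eq_0[where b = b])
  show "block_mat (rk A) (nmat (chart_at A x) x)
        (block_mat (rk A) (dnmat (chart_at A x) (coord (chart_at A x) x) i) u) k =
    - block_mat (rk A) (dnmat (chart_at A x) (coord (chart_at A x) x) i)
        (block_mat (rk A) (nmat (chart_at A x) x) u) k"
    if "k < 2 * rk A" for i u k
    using block_mat_nmat_dnmat[OF chart_at(1) chart_point_at(2) that, of x i u] by (simp add: chart_point_at(1))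
  show "in_half (rk A) b (anchor_coef T i)" for i
    using a by (auto simp: in_half_def anchor_coef_def)
  show "of_bool ((j < rk A) = b) + of_bool ((k < rk A) = b) + of_bool ((m < rk A) = b) = (2 :: nat)"
    if "bracket_coef T j k m \<noteq> 0" for j k m
  proof -
    have "j \<noteq> k" "j \<noteq> m" "k \<noteq> m" "T {#} {j, k, m} \<noteq> 0"
      using that unfolding bracket_coef_def by (metis mult_zero_right)+
    then show ?thesis
      using h[of "{j, k, m}"] by (simp add: add.assoc del: sum_of_bool_eq)
  qed
qed (use base bracket_coef_swap12 bracket_coef_swap23 in blast)+

text \<open>The torsion form depends on the values at \<open>x\<close> only, so \<open>u\<close> and \<open>v\<close> may be replaced by global sections
  of A with these values.\<close>

lemma torsion_form_at_lie_algebroid: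
  assumes \<mu>: "lie_algebroid A \<mu>" and nij: "nijenhuis A \<mu> N"
  shows "torsion_form_at (\<mu> (chart_at A x) (coord (chart_at A x) x)) x u v w = 0"
proof (rule torsion_form_at_eq_0[where b = True])
  define c where "c = chart_at A x"
  note c = chart_at[of x, folded c_def]
  let ?T = "\<mu> (chart_at A x) (coord (chart_at A x) x)" and ?r = "rk A"
  have supp: "(\<exists>i<dimM A. \<exists>\<alpha><?r. I = {#i#} \<and> S = {\<alpha>}) \<or>
      (\<exists>\<alpha><?r. \<exists>\<beta><?r. \<exists>\<gamma><?r. \<alpha> \<noteq> \<beta> \<and> I = {#} \<and> S = {\<alpha>, \<beta>, ?r + \<gamma>})"
    if "?T I S \<noteq> 0" for I S
    using \<mu> that chart_at(1) chart_point_at(2) unfolding lie_algebroid_def by blast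
  show "(k < ?r) = True" if "?T {#i#} {k} \<noteq> 0" for i k
    using supp[OF that] by auto
  show "(\<Sum>k\<in>S. of_bool ((k < ?r) = True)) = (2 :: nat)" if "?T {#} S \<noteq> 0" for S
    using supp[OF that] by auto
  fix u v w assume uv: "in_half ?r (\<not> True) u" "in_half ?r (\<not> True) v" and w: "in_half ?r True w"
  have "\<exists>X\<in>sec A. \<forall>k<2 * ?r. ecoef A c (X, 0) x k = u k" if u: "in_half ?r (\<not> True) u" for u
  proof -
    let ?a = "inv_into (fibre A x) (triv c) (\<lambda>\<alpha>. if \<alpha> < ?r then u (?r + \<alpha>) else 0)"
    have a: "?a \<in> fibre A x" "triv c ?a = (\<lambda>\<alpha>. if \<alpha> < ?r then u (?r + \<alpha>) else 0)"
      using triv_inv[OF c, of "\<lambda>\<alpha>. if \<alpha> < ?r then u (?r + \<alpha>) else 0"] by simp_all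
    obtain X where "X \<in> sec A" "X x = ?a"
      by (rule extend_vector[OF a(1)], rule that)
    then show ?thesis
      using a(2) u by (intro bexI[of _ X]) (auto simp: ecoef_def in_half_def)
  qed
  then obtain X Y where XY: "X \<in> sec A" "Y \<in> sec A"
    and p: "\<And>k. k < 2 * ?r \<Longrightarrow> ecoef A c (X, 0) x k = u k" "\<And>k. k < 2 * ?r \<Longrightarrow> ecoef A c (Y, 0) x k = v k"
    using uv by meson
  have sec: "(X, 0) \<in> esec A" "(Y, 0) \<in> esec A"
    using XY zero_dsec by (simp_all add: esec_def)
  let ?\<tau> = "block_torsion \<mu> (X, 0) (Y, 0)"
  have "block_endo N (Z, 0) = (sec_endo N Z, 0)" for Z
    by (simp add: block_endo_def transpose_endo_def fun_eq_iff)
  \<comment> \<open>On sections of A, the A-component of the torsion of the block endomorphism is that of \<open>N\<close>.\<close>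
  then have "fst ?\<tau> = torsion (sadd A) (ssub A) (lie_bracket A \<mu>) (sec_endo N) X Y"
    by (simp add: block_torsion_def torsion_def esub_def eadd_def block_endo_def
        lie_bracket_def dorfman_def to_esec_def)
  then have "fst ?\<tau> = fzero A"
    using nij XY by (simp add: nijenhuis_def)
  then have "cpair ?r (ecoef A c ?\<tau> x) w = 0"
    using triv_linear(1)[OF c] w by (auto simp: cpair_def ecoef_def in_half_def intro!: sum.neutral)
  moreover have "torsion_form_at ?T x (ecoef A c (X, 0) x) (ecoef A c (Y, 0) x) w =
      torsion_form_at ?T x u v w"
    using p by (rule torsion_form_cong)
  ultimately show "torsion_form_at ?T x u v w = 0"
    using torsion_at[OF sec, of x \<mu> w] by (simp add: c_def)
qed

lemma torsion_form_at_dual_lie_algebroid: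
  assumes \<gamma>: "dual_lie_algebroid A \<gamma>" and nij: "dual_nijenhuis A \<gamma> N"
  shows "torsion_form_at (\<gamma> (chart_at A x) (coord (chart_at A x) x)) x u v w = 0"
proof (rule torsion_form_at_eq_0[where b = False])
  define c where "c = chart_at A x"
  note c = chart_at[of x, folded c_def]
  let ?T = "\<gamma> (chart_at A x) (coord (chart_at A x) x)" and ?r = "rk A"
  have supp: "(\<exists>i<dimM A. \<exists>\<alpha><?r. I = {#i#} \<and> S = {?r + \<alpha>}) \<or>
      (\<exists>\<alpha><?r. \<exists>\<beta><?r. \<exists>\<kappa><?r. \<alpha> \<noteq> \<beta> \<and> I = {#} \<and> S = {?r + \<alpha>, ?r + \<beta>, \<kappa>})"
    if "?T I S \<noteq> 0" for I S
    using \<gamma> that chart_at(1) chart_point_at(2) unfolding dual_lie_algebroid_def by blast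
  show "(k < ?r) = False" if "?T {#i#} {k} \<noteq> 0" for i k
    using supp[OF that] by auto
  show "(\<Sum>k\<in>S. of_bool ((k < ?r) = False)) = (2 :: nat)" if "?T {#} S \<noteq> 0" for S
    using supp[OF that] by auto
  fix u v w assume uv: "in_half ?r (\<not> False) u" "in_half ?r (\<not> False) v" and w: "in_half ?r False w"
  have "\<exists>\<xi>\<in>dsec A. \<forall>k<2 * ?r. ecoef A c (fzero A, \<xi>) x k = u k" if u: "in_half ?r (\<not> False) u" for u
  proof -
    obtain \<xi> where "\<xi> \<in> dsec A" "\<And>\<alpha>. \<alpha> < ?r \<Longrightarrow> \<xi> (frame A c x \<alpha>) = u \<alpha>"
      by (rule extend_covector[OF c, of u], rule that)
    then show ?thesis
      using triv_linear(1)[OF c] u by (intro bexI[of _ \<xi>]) (auto simp: ecoef_def in_half_def)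
  qed
  then obtain \<xi> \<eta> where dsec: "\<xi> \<in> dsec A" "\<eta> \<in> dsec A"
    and p: "\<And>k. k < 2 * ?r \<Longrightarrow> ecoef A c (fzero A, \<xi>) x k = u k"
      "\<And>k. k < 2 * ?r \<Longrightarrow> ecoef A c (fzero A, \<eta>) x k = v k"
    using uv by meson
  have sec: "(fzero A, \<xi>) \<in> esec A" "(fzero A, \<eta>) \<in> esec A"
    using dsec fzero_sec by (simp_all add: esec_def)
  let ?\<tau> = "block_torsion \<gamma> (fzero A, \<xi>) (fzero A, \<eta>)"
  have "N (fzero A z) = fzero A z" for z
    using endo_props(3)[of 0 "fzero A z"] endo_props(1)[OF fibre_closed(1)] fibre_closed(1)
    by (metis fscale_0)
  then have P: "block_endo N (fzero A, \<zeta>) = (fzero A, - transpose_endo N \<zeta>)" for \<zeta>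
    by (simp add: block_endo_def sec_endo_def fun_eq_iff)
  have "- transpose_endo N \<zeta> \<in> dsec A" if "\<zeta> \<in> dsec A" for \<zeta>
    using block_esec[of "(fzero A, \<zeta>)"] that fzero_sec unfolding P by (simp add: esec_def)
  then have tr: "transpose_endo N \<zeta> \<in> dsec A" if "\<zeta> \<in> dsec A" for \<zeta>
    using uminus_dsec[of "- transpose_endo N \<zeta>"] that by simp
  have snd_dorfman: "snd (dorfman A \<gamma> (fzero A, \<zeta>) (fzero A, \<zeta>')) = dual_lie_bracket A \<gamma> \<zeta> \<zeta>'" for \<zeta> \<zeta>'
    by (simp add: dorfman_def to_esec_def dual_lie_bracket_def)
  \<comment> \<open>The torsion is quadratic in the endomorphism, hence the same for minus the transpose.\<close>
  have "snd ?\<tau> = torsion (+) (-) (dual_lie_bracket A \<gamma>) (transpose_endo N) \<xi> \<eta>"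
    unfolding block_torsion_def torsion_def P
    by (simp add: esub_def eadd_def block_endo_def snd_dorfman dual_lie_bracket_uminus
        dsec tr uminus_dsec) (simp add: transpose_endo_def fun_eq_iff)
  then have "snd ?\<tau> = 0"
    using nij dsec by (simp add: dual_nijenhuis_def)
  then have "cpair ?r (ecoef A c ?\<tau> x) w = 0"
    using w by (auto simp: cpair_def ecoef_def in_half_def intro!: sum.neutral)
  moreover have "torsion_form_at ?T x (ecoef A c (fzero A, \<xi>) x) (ecoef A c (fzero A, \<eta>) x) w =
      torsion_form_at ?T x u v w"
    using p by (rule torsion_form_cong)
  ultimately show "torsion_form_at ?T x u v w = 0"
    using torsion_at[OF sec, of x \<gamma> w] by (simp add: c_def)
qed

lemma block_torsion_zero:
  assumes "lie_algebroid A \<mu>" "nijenhuis A \<mu> N" "dual_lie_algebroid A \<gamma>" "dual_nijenhuis A \<gamma> N"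
    and u: "u \<in> esec A" and v: "v \<in> esec A"
  shows "block_torsion (\<mu> + \<gamma>) u v = ezero A"
proof -
  let ?\<tau> = "block_torsion (\<mu> + \<gamma>) u v"
  have coef: "ecoef A (chart_at A x) ?\<tau> x k = 0" if "k < 2 * rk A" for x k
  proof (rule cpair_nondegenerate[OF _ that])
    fix w
    define c where "c = chart_at A x"
    let ?y = "coord c x"
    have "anchor_coef ((\<mu> + \<gamma>) c ?y) = (\<lambda>i k. anchor_coef (\<mu> c ?y) i k + anchor_coef (\<gamma> c ?y) i k)"
      "bracket_coef ((\<mu> + \<gamma>) c ?y) = (\<lambda>j k m. bracket_coef (\<mu> c ?y) j k m + bracket_coef (\<gamma> c ?y) j k m)"
      by (auto simp: anchor_coef_def bracket_coef_def fun_eq_iff algebra_simps)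
    then have "cpair (rk A) (ecoef A c ?\<tau> x) w = torsion_form_at (\<mu> c ?y) x (ecoef A c u x) (ecoef A c v x) w
        + torsion_form_at (\<gamma> c ?y) x (ecoef A c u x) (ecoef A c v x) w"
      using torsion_at[OF u v, of x "\<mu> + \<gamma>" w] by (simp add: c_def torsion_form_sum_coeffs)
    then show "cpair (rk A) (ecoef A (chart_at A x) ?\<tau> x) w = 0"
      using torsion_form_at_lie_algebroid[OF assms(1,2)] torsion_form_at_dual_lie_algebroid[OF assms(3,4)]
      by (simp add: c_def)
  qed
  have "fst ?\<tau> x = fzero A x" for x
    using lin_at_zero(1)[OF chart_at lin_at_torsion coef] by simp
  moreover have "snd ?\<tau> a = 0" for a
  proof -
    have "a \<in> fibre A (proj A a)" by (simp add: fibre_def)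
    from lin_at_zero(2)[OF chart_at lin_at_torsion coef this] show ?thesis by simp
  qed
  ultimately show ?thesis
    by (simp add: ezero_def prod_eq_iff fun_eq_iff)
qed

end

lemma block_e_endo: "e_endo A (block_endo N)"
proof -
  have "N (fadd A (fst u x) (fst v x)) = fadd A (N (fst u x)) (N (fst v x))"
    if "u \<in> esec A" "v \<in> esec A" for u v x
    using lin_at_esec[OF that(1), of x] lin_at_esec[OF that(2), of x] endo_props(2)
    by (auto simp: lin_at_def)
  moreover have "proj A (N a) = proj A a" for a
    using endo_props(1)[of a "proj A a"] by (simp add: fibre_def)
  ultimately show ?thesis
    using block_esec endo_props(3)
    by (auto simp: e_endo_def block_endo_def eadd_def emul_def sadd_def smul_def sec_endo_def
        transpose_endo_def fun_eq_iff)
qed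

end

end

lemma block_skew: "pairing (block_endo N u) v + pairing u (block_endo N v) = 0"
  by (simp add: pairing_def block_endo_def sec_endo_def transpose_endo_def fun_eq_iff)

lemma proportional_cps_square:
  assumes vb: "vector_bundle A" and P: "almost_cps A P" and NP: "proportional A N P"
  obtains t where "\<And>a. N (N a) = fscale A t a"
proof -
  obtain s where s: "\<And>a. N a = fscale A s (P a)"
    using NP by (auto simp: proportional_def)
  obtain \<epsilon> where \<epsilon>: "\<And>a. P (P a) = fscale A \<epsilon> a"
    using P by (auto simp: almost_cps_def)
  have "N (N a) = fscale A (s * s * \<epsilon>) a" for a
  proof -
    let ?x = "proj A a"
    have a: "a \<in> fibre A ?x" by (simp add: fibre_def)
    note fib = fibre_closed(3)[OF vb] and lin = triv_linear(3)[OF vb chart_at[OF vb, of ?x]]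
    have "N (N a) = fscale A s (fscale A s (fscale A \<epsilon> a))"
      using P \<epsilon> by (simp add: s almost_cps_def bundle_endo_def)
    also have "\<dots> = fscale A (s * s * \<epsilon>) a"
      by (rule triv_eqI[OF vb chart_at[OF vb, of ?x]]) (use a fib lin in auto)
    finally show ?thesis .
  qed
  then show ?thesis using that by blast
qed

theorem theorem4p8:
  fixes A :: "('m::{t2_space,second_countable_topology}, 'a, 'e::real_inner) vbundle"
    and \<mu> \<gamma> :: "('m, 'a, 'e) gfun"
    and N P :: "'a \<Rightarrow> 'a"
  assumes "vector_bundle A"
    and "lie_bialgebroid A \<mu> \<gamma>"
    and "bundle_endo A N"
    and "almost_cps A P" and "proportional A N P"
    and "nijenhuis A \<mu> N"
    and "dual_nijenhuis A \<gamma> N"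
  shows "courant_nijenhuis A (\<mu> + \<gamma>) (block_endo N)"
proof -
  obtain t where t: "\<And>a. N (N a) = fscale A t a"
    by (rule proportional_cps_square[OF assms(1,4,5)], rule that)
  have "block_torsion A N (\<mu> + \<gamma>) u v = ezero A" if "u \<in> esec A" "v \<in> esec A" for u v
    using block_torsion_zero[OF assms(1,3) t _ assms(6) _ assms(7) that] assms(2)
    by (simp add: lie_bialgebroid_def)
  then show ?thesis
    using block_e_endo[OF assms(1,3)] block_skew
    unfolding courant_nijenhuis_def block_torsion_def[OF assms(1,3) t] by blast
qed

end
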